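(* Let $H$ be the sub-Riemannian Lie group defined as follows: $\mathfrak h$ is the $4$-dimensional real Lie algebra with basis $Y_1,Y_2,Y_3,Z$ and brackets $$[Y_1,Y_2]=Z,\quad[Y_3,Y_1]=Y_1,\quad[Y_3,Y_2]=Y_2,\quad[Y_3,Z]=2Z,$$ all other brackets of basis vectors being zero; $H$ is the corresponding connected and simply connected Lie group, polarized by $V(H):=\langle Y_1,Y_2,Y_3\rangle$, with $Y_1,Y_2,Y_3$ declared orthonormal, and endowed with a left Haar measure $\mathrm{vol}_H$. Let $\Omega\subset H$ be a non-empty bounded open set and let $F:=\mathrm{Id}|_\Omega:\Omega\to H$. Then: (i) $F$ is a harmonic morphism, it is a conformal submersion of factor $\lambda\equiv1$, and $\mathscr T(F)=0$; (ii) $F$ is not a harmonic map: there are contact variations of $F$ along which the horizontal energy strictly decreases, i.e. contact variations $(F_s)_s$ of $F$ with $\mathscr E(F_s)<\mathscr E(F)$ for all sufficiently small $s>0$.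
   Context: For a Lie group $G$, $\mathfrak g=T_{1_G}G$ is its Lie algebra; for $v\in\mathfrak g$, $\tilde v$ is the left-invariant vector field with value $v$ at $1_G$, so $\tilde vf(p)=\frac{\mathrm d}{\mathrm dt}|_{t=0}f(p\exp(tv))$. A sub-Riemannian Lie group is a connected Lie group $G$ with a linear subspace $V(G)\subset\mathfrak g$ (the polarization) generating $\mathfrak g$ as a Lie algebra, a scalar product $\langle\cdot,\cdot\rangle_G$ on $V(G)$, and a left Haar measure $\mathrm{vol}_G$. Let $G,H$ be sub-Riemannian Lie groups, $\Omega\subset G$ open, $X_1,\dots,X_m$ an orthonormal basis of $V(G)$. Sub-Laplacian: $\triangle_G u=\operatorname{div}_{\mathrm{vol}_G}\bigl(\sum_i(\tilde X_iu)\tilde X_i\bigr)$, where $\int(\operatorname{div}_{\mathrm{vol}_G}X)\phi\,\mathrm{dvol}_G=-\int \mathrm d\phi[X]\,\mathrm{dvol}_G$ for all $\phi\in C_c^\infty$. A function $u$ is harmonic if $\triangle_Gu=0$. A harmonic morphism $F:\Omega\to H$ is a continuous map such that for every open $U\subset H$ and harmonic $u:U\to\mathbb R$, $u\circ F$ is harmonic on $F^{-1}(U)$. Lie differentials: $\mathrm DF(p)[v]=\frac{\mathrm d}{\mathrm dt}|_{t=0}F(p)^{-1}F(p\exp(tv))\in\mathfrak h$ and $\mathrm D^2F(p)[v,w]=\frac{\mathrm d}{\mathrm dt}|_{t=0}\mathrm DF(p\exp(tw))[v]$. $F$ is a contact map if $\mathrm DF(p)[V(G)]\subseteq V(H)$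 for all $p$. A contact map is a conformal submersion of factor $\lambda:\Omega\to[0,+\infty)$ if for every $p$ the map $L=\mathrm DF(p)|_{V(G)}:V(G)\to V(H)$ satisfies $\langle L^Tw_1,L^Tw_2\rangle_G=\lambda(p)^2\langle w_1,w_2\rangle_H$ for all $w_1,w_2\in V(H)$. The modular vector $\mathfrak m_G\in V(G)$ is determined by $\langle\mathfrak m_G,v\rangle_G=\operatorname{tr}(\mathrm{ad}_v)$ for all $v\in V(G)$. For a $C^2$ conformal submersion, $\mathscr T(F):=\sum_i\mathrm D^2F[X_i,X_i]-\mathrm DF[\mathfrak m_G]+\lambda^2\mathfrak m_H:\Omega\to V(H)$. Horizontal energy: $\mathscr E(F)=\frac12\int_\Omega\sum_{i}|\mathrm DF[X_i]|_H^2\,\mathrm{dvol}_G$. A contact variation of a smooth contact map $F$ is a smooth family $(F_s)_{s\in(-\epsilon,\epsilon)}$ of contact maps $\Omega\to H$ with $F_0=F$ and such that, for some compact $K\subset\Omega$, $F_s=F$ on $\Omega\setminus K$ for every $s$. $F$ is a harmonic map if $\frac{\mathrm d}{\mathrm ds}|_{s=0}\frac12\int_K\sum_i|\mathrm DF_s[X_i]|_H^2\,\mathrm{dvol}_G=0$ for every contact variation of $F$. *)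

theory Defs
  imports "HOL-Analysis.Analysis" "HOL-Algebra.Group"
begin

section \<open>Functions of class \<open>C\<^sup>k\<close> on an open set\<close>

primrec Ck_on :: "nat \<Rightarrow> 'a::euclidean_space set \<Rightarrow> ('a \<Rightarrow> 'b::euclidean_space) \<Rightarrow> bool" where
  "Ck_on 0 S f \<longleftrightarrow> continuous_on S f"
| "Ck_on (Suc k) S f \<longleftrightarrow>
     (\<forall>x\<in>S. f differentiable (at x)) \<and> (\<forall>v. Ck_on k S (\<lambda>x. frechet_derivative f (at x) v))"

definition smooth_on :: "'a::euclidean_space set \<Rightarrow> ('a \<Rightarrow> 'b::euclidean_space) \<Rightarrow> bool" where
  "smooth_on S f \<longleftrightarrow> (\<forall>k. Ck_on k S f)"

section \<open>Lie groups in a global chart\<close>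

text \<open>
  All Lie groups below have a Euclidean space \<open>'a\<close> as underlying manifold (in particular they are
  connected and simply connected). Tangent vectors at every point, and in particular
  the elements of the Lie algebra (the tangent space at the identity), are then elements of \<open>'a\<close>.
\<close>

definition lie_group :: "('a::euclidean_space, 'm) monoid_scheme \<Rightarrow> bool" where
  "lie_group G \<longleftrightarrow> group G \<and> carrier G = UNIV \<and>
     smooth_on UNIV (\<lambda>(p, q). p \<otimes>\<^bsub>G\<^esub> q) \<and> smooth_on UNIV (\<lambda>p. inv\<^bsub>G\<^esub> p)"

definition one_parameter_subgroup ::
    "('a::euclidean_space, 'm) monoid_scheme \<Rightarrow> 'a \<Rightarrow> (real \<Rightarrow> 'a) \<Rightarrow> bool" where
  "one_parameter_subgroup G v \<gamma> \<longleftrightarrow>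
     (\<forall>s t. \<gamma> (s + t) = \<gamma> s \<otimes>\<^bsub>G\<^esub> \<gamma> t) \<and> (\<gamma> has_vector_derivative v) (at 0)"

definition lie_exp :: "('a::euclidean_space, 'm) monoid_scheme \<Rightarrow> 'a \<Rightarrow> 'a" where
  "lie_exp G v = (THE \<gamma>. one_parameter_subgroup G v \<gamma>) 1"

text \<open>The left-invariant vector field \<open>\<tilde>v\<close>, in the chart and as a derivation.\<close>

definition left_field :: "('a::euclidean_space, 'm) monoid_scheme \<Rightarrow> 'a \<Rightarrow> 'a \<Rightarrow> 'a" where
  "left_field G v p = vector_derivative (\<lambda>t. p \<otimes>\<^bsub>G\<^esub> lie_exp G (t *\<^sub>R v)) (at 0)"

definition left_deriv ::
    "('a::euclidean_space, 'm) monoid_scheme \<Rightarrow> 'a \<Rightarrow> ('a \<Rightarrow> real) \<Rightarrow> 'a \<Rightarrow> real" where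
  "left_deriv G v f p = vector_derivative (\<lambda>t. f (p \<otimes>\<^bsub>G\<^esub> lie_exp G (t *\<^sub>R v))) (at 0)"

text \<open>
  The Lie bracket is the commutator of left-invariant vector fields at the identity, with the
  convention \<open>[X, Y] f = X (Y f) - Y (X f)\<close>, i.e. \<open>[X, Y] = DY[X] - DX[Y]\<close> in the chart.
\<close>

definition lie_bracket :: "('a::euclidean_space, 'm) monoid_scheme \<Rightarrow> 'a \<Rightarrow> 'a \<Rightarrow> 'a" where
  "lie_bracket G v w =
     frechet_derivative (left_field G w) (at \<one>\<^bsub>G\<^esub>) v -
     frechet_derivative (left_field G v) (at \<one>\<^bsub>G\<^esub>) w"

definition trace_ad :: "('a::euclidean_space, 'm) monoid_scheme \<Rightarrow> 'a \<Rightarrow> real" where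
  "trace_ad G v = (\<Sum>b\<in>Basis. lie_bracket G v b \<bullet> b)"

definition left_haar_measure ::
    "('a::euclidean_space, 'm) monoid_scheme \<Rightarrow> 'a measure \<Rightarrow> bool" where
  "left_haar_measure G M \<longleftrightarrow>
     sets M = sets borel \<and>
     (\<forall>g. \<forall>A\<in>sets borel. emeasure M ((\<lambda>p. g \<otimes>\<^bsub>G\<^esub> p) ` A) = emeasure M A) \<and>
     (\<forall>K. compact K \<longrightarrow> emeasure M K < \<infinity>) \<and>
     emeasure M UNIV \<noteq> 0"

section \<open>Sub-Riemannian Lie groups\<close>

text \<open>Only the restriction of \<open>ip G\<close> to the polarization \<open>pol G\<close> is meaningful.\<close>

record 'a sr_group = "'a monoid" +
  pol :: "'a set"
  ip :: "'a \<Rightarrow> 'a \<Rightarrow> real"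
  vol :: "'a measure"

definition scalar_product_on :: "'a::euclidean_space set \<Rightarrow> ('a \<Rightarrow> 'a \<Rightarrow> real) \<Rightarrow> bool" where
  "scalar_product_on V b \<longleftrightarrow>
     (\<forall>u\<in>V. \<forall>v\<in>V. \<forall>w\<in>V. \<forall>c. b (u + v) w = b u w + b v w \<and> b (c *\<^sub>R u) w = c * b u w) \<and>
     (\<forall>u\<in>V. \<forall>v\<in>V. b u v = b v u) \<and>
     (\<forall>u\<in>V. u \<noteq> 0 \<longrightarrow> b u u > 0)"

definition sub_riemannian_lie_group :: "'a::euclidean_space sr_group \<Rightarrow> bool" where
  "sub_riemannian_lie_group G \<longleftrightarrow>
     lie_group G \<and> subspace (pol G) \<and>
     ((\<lambda>W. subspace W \<and> (\<forall>v\<in>W. \<forall>w\<in>W. lie_bracket G v w \<in> W)) hull pol G) = UNIV \<and>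
     scalar_product_on (pol G) (ip G) \<and>
     left_haar_measure G (vol G)"

definition orthonormal_basis :: "'a::euclidean_space sr_group \<Rightarrow> 'a set \<Rightarrow> bool" where
  "orthonormal_basis G B \<longleftrightarrow>
     finite B \<and> span B = pol G \<and> (\<forall>v\<in>B. \<forall>w\<in>B. ip G v w = (if v = w then 1 else 0))"

text \<open>
  The orthonormal basis \<open>X\<^sub>1, \<dots>, X\<^sub>m\<close> of \<open>V(G)\<close>. It is an arbitrary one: no property beyond
  \<open>orthonormal_basis\<close> is available, and nothing defined from it depends on the choice.
\<close>

definition onb :: "'a::euclidean_space sr_group \<Rightarrow> 'a set" where
  "onb G = (SOME B. orthonormal_basis G B)"

definition modular_vector :: "'a::euclidean_space sr_group \<Rightarrow> 'a" where
  "modular_vector G = (THE m. m \<in> pol G \<and> (\<forall>v\<in>pol G. ip G m v = trace_ad G v))"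

section \<open>Harmonic functions and harmonic morphisms\<close>

text \<open>\<open>h\<close> is the divergence on the open set \<open>U\<close> of the vector field \<open>X\<close>, given in the chart.\<close>

definition is_divergence ::
    "'a::euclidean_space sr_group \<Rightarrow> 'a set \<Rightarrow> ('a \<Rightarrow> 'a) \<Rightarrow> ('a \<Rightarrow> real) \<Rightarrow> bool" where
  "is_divergence G U X h \<longleftrightarrow> continuous_on U h \<and>
     (\<forall>\<phi> K. smooth_on UNIV \<phi> \<and> compact K \<and> K \<subseteq> U \<and> (\<forall>p. p \<notin> K \<longrightarrow> \<phi> p = 0) \<longrightarrow>
        (LINT p:U|vol G. h p * \<phi> p) = - (LINT p:U|vol G. frechet_derivative \<phi> (at p) (X p)))"

definition is_sub_laplacian ::
    "'a::euclidean_space sr_group \<Rightarrow> 'a set \<Rightarrow> ('a \<Rightarrow> real) \<Rightarrow> ('a \<Rightarrow> real) \<Rightarrow> bool" where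
  "is_sub_laplacian G U u h \<longleftrightarrow>
     is_divergence G U (\<lambda>p. \<Sum>X\<in>onb G. left_deriv G X u p *\<^sub>R left_field G X p) h"

text \<open>
  Requiring smoothness is no restriction: the sub-Laplacian is hypoelliptic, so that even
  distributional solutions are smooth.
\<close>

definition harmonic_on :: "'a::euclidean_space sr_group \<Rightarrow> 'a set \<Rightarrow> ('a \<Rightarrow> real) \<Rightarrow> bool" where
  "harmonic_on G U u \<longleftrightarrow> smooth_on U u \<and> is_sub_laplacian G U u (\<lambda>_. 0)"

definition harmonic_morphism ::
    "'a::euclidean_space sr_group \<Rightarrow> 'b::euclidean_space sr_group \<Rightarrow> 'a set \<Rightarrow> ('a \<Rightarrow> 'b) \<Rightarrow> bool" where
  "harmonic_morphism G H \<Omega> F \<longleftrightarrow> continuous_on \<Omega> F \<and>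
     (\<forall>U u. open U \<and> harmonic_on H U u \<longrightarrow> harmonic_on G {p \<in> \<Omega>. F p \<in> U} (u \<circ> F))"

section \<open>Lie differentials, contact maps and conformal submersions\<close>

definition DF :: "'a::euclidean_space sr_group \<Rightarrow> 'b::euclidean_space sr_group \<Rightarrow>
    ('a \<Rightarrow> 'b) \<Rightarrow> 'a \<Rightarrow> 'a \<Rightarrow> 'b" where
  "DF G H F p v =
     vector_derivative (\<lambda>t. inv\<^bsub>H\<^esub> (F p) \<otimes>\<^bsub>H\<^esub> F (p \<otimes>\<^bsub>G\<^esub> lie_exp G (t *\<^sub>R v))) (at 0)"

definition D2F :: "'a::euclidean_space sr_group \<Rightarrow> 'b::euclidean_space sr_group \<Rightarrow>
    ('a \<Rightarrow> 'b) \<Rightarrow> 'a \<Rightarrow> 'a \<Rightarrow> 'a \<Rightarrow> 'b" where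
  "D2F G H F p v w =
     vector_derivative (\<lambda>t. DF G H F (p \<otimes>\<^bsub>G\<^esub> lie_exp G (t *\<^sub>R w)) v) (at 0)"

definition contact_map :: "'a::euclidean_space sr_group \<Rightarrow> 'b::euclidean_space sr_group \<Rightarrow>
    'a set \<Rightarrow> ('a \<Rightarrow> 'b) \<Rightarrow> bool" where
  "contact_map G H \<Omega> F \<longleftrightarrow>
     Ck_on 1 \<Omega> F \<and> (\<forall>p\<in>\<Omega>. \<forall>v\<in>pol G. DF G H F p v \<in> pol H)"

definition sr_adjoint :: "'a::euclidean_space sr_group \<Rightarrow> 'b::euclidean_space sr_group \<Rightarrow>
    ('a \<Rightarrow> 'b) \<Rightarrow> 'b \<Rightarrow> 'a" where
  "sr_adjoint G H L w = (THE u. u \<in> pol G \<and> (\<forall>v\<in>pol G. ip G u v = ip H w (L v)))"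

definition conformal_submersion ::
    "'a::euclidean_space sr_group \<Rightarrow> 'b::euclidean_space sr_group \<Rightarrow>
     'a set \<Rightarrow> ('a \<Rightarrow> 'b) \<Rightarrow> ('a \<Rightarrow> real) \<Rightarrow> bool" where
  "conformal_submersion G H \<Omega> F fac \<longleftrightarrow>
     contact_map G H \<Omega> F \<and>
     (\<forall>p\<in>\<Omega>. fac p \<ge> 0 \<and>
        (\<forall>w1\<in>pol H. \<forall>w2\<in>pol H.
           ip G (sr_adjoint G H (DF G H F p) w1) (sr_adjoint G H (DF G H F p) w2)
             = (fac p)\<^sup>2 * ip H w1 w2))"

definition tension :: "'a::euclidean_space sr_group \<Rightarrow> 'b::euclidean_space sr_group \<Rightarrow>
    ('a \<Rightarrow> 'b) \<Rightarrow> ('a \<Rightarrow> real) \<Rightarrow> 'a \<Rightarrow> 'b" where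
  "tension G H F fac p =
     (\<Sum>X\<in>onb G. D2F G H F p X X) - DF G H F p (modular_vector G)
       + (fac p)\<^sup>2 *\<^sub>R modular_vector H"

section \<open>Horizontal energy and harmonic maps\<close>

definition energy_density :: "'a::euclidean_space sr_group \<Rightarrow> 'b::euclidean_space sr_group \<Rightarrow>
    ('a \<Rightarrow> 'b) \<Rightarrow> 'a \<Rightarrow> real" where
  "energy_density G H F p = (\<Sum>X\<in>onb G. ip H (DF G H F p X) (DF G H F p X))"

text \<open>The energy over all of \<open>\<Omega>\<close> is a possibly infinite integral of a nonnegative function.\<close>

definition energy :: "'a::euclidean_space sr_group \<Rightarrow> 'b::euclidean_space sr_group \<Rightarrow>
    'a set \<Rightarrow> ('a \<Rightarrow> 'b) \<Rightarrow> ennreal" where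
  "energy G H \<Omega> F = ennreal (1/2) * (\<integral>\<^sup>+p\<in>\<Omega>. ennreal (energy_density G H F p) \<partial>vol G)"

definition contact_variation ::
    "'a::euclidean_space sr_group \<Rightarrow> 'b::euclidean_space sr_group \<Rightarrow>
     'a set \<Rightarrow> ('a \<Rightarrow> 'b) \<Rightarrow> real \<Rightarrow> 'a set \<Rightarrow> (real \<Rightarrow> 'a \<Rightarrow> 'b) \<Rightarrow> bool" where
  "contact_variation G H \<Omega> F \<epsilon> K Fs \<longleftrightarrow>
     \<epsilon> > 0 \<and> compact K \<and> K \<subseteq> \<Omega> \<and>
     smooth_on ({-\<epsilon><..<\<epsilon>} \<times> \<Omega>) (\<lambda>(s, p). Fs s p) \<and>
     (\<forall>s\<in>{-\<epsilon><..<\<epsilon>}. contact_map G H \<Omega> (Fs s)) \<and>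
     (\<forall>p\<in>\<Omega>. Fs 0 p = F p) \<and>
     (\<forall>s\<in>{-\<epsilon><..<\<epsilon>}. \<forall>p\<in>\<Omega> - K. Fs s p = F p)"

definition harmonic_map :: "'a::euclidean_space sr_group \<Rightarrow> 'b::euclidean_space sr_group \<Rightarrow>
    'a set \<Rightarrow> ('a \<Rightarrow> 'b) \<Rightarrow> bool" where
  "harmonic_map G H \<Omega> F \<longleftrightarrow>
     smooth_on \<Omega> F \<and> contact_map G H \<Omega> F \<and>
     (\<forall>\<epsilon> K Fs. contact_variation G H \<Omega> F \<epsilon> K Fs \<longrightarrow>
        ((\<lambda>s. 1/2 * (LINT p:K|vol G. energy_density G H (Fs s) p))
           has_real_derivative 0) (at 0))"

section \<open>The group \<open>H\<close>\<close>

text \<open>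
  \<open>H\<close> is the semidirect product of the Heisenberg group with the real line acting by the
  dilations \<open>(x, y, z) \<mapsto> (e\<^sup>t x, e\<^sup>t y, e\<^sup>2\<^sup>t z)\<close>. The coordinates \<open>(x, y, z, t)\<close> are those of the
  point \<open>exp (x Y\<^sub>1 + y Y\<^sub>2 + z Z) exp (t Y\<^sub>3)\<close>.
\<close>

type_synonym real4 = "real \<times> real \<times> real \<times> real"

fun H_mult :: "real4 \<Rightarrow> real4 \<Rightarrow> real4" where
  "H_mult (x, y, z, t) (x', y', z', t') =
     (x + exp t * x', y + exp t * y', z + exp (2 * t) * z' + exp t * (x * y' - y * x') / 2, t + t')"

definition Y1 :: real4 where "Y1 = (1, 0, 0, 0)"
definition Y2 :: real4 where "Y2 = (0, 1, 0, 0)"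
definition Y3 :: real4 where "Y3 = (0, 0, 0, 1)"
definition Z :: real4 where "Z = (0, 0, 1, 0)"

text \<open>
  The standard inner product of \<open>\<real>\<^sup>4\<close>, restricted to the polarization, is the
  scalar product for which \<open>Y\<^sub>1, Y\<^sub>2, Y\<^sub>3\<close> are orthonormal.
\<close>

definition H_group :: "real4 measure \<Rightarrow> real4 sr_group" where
  "H_group \<mu> = \<lparr>carrier = UNIV, mult = H_mult, one = (0, 0, 0, 0),
     pol = span {Y1, Y2, Y3}, ip = (\<bullet>), vol = \<mu>\<rparr>"

lemma H_simps [simp]:
  "carrier (H_group \<mu>) = UNIV" "mult (H_group \<mu>) = H_mult" "one (H_group \<mu>) = (0, 0, 0, 0)"
  "pol (H_group \<mu>) = span {Y1, Y2, Y3}" "ip (H_group \<mu>) = (\<bullet>)" "vol (H_group \<mu>) = \<mu>"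
  by (simp_all add: H_group_def)

lemma H_assoc: "H_mult (H_mult p q) r = H_mult p (H_mult q r)"
proof -
  have "exp (2 * t) = exp t * exp t" for t :: real
    by (simp flip: exp_add)
  then show ?thesis
    by (cases p; cases q; cases r) (simp add: field_simps exp_add)
qed

fun H_inv :: "real4 \<Rightarrow> real4" where
  "H_inv (x, y, z, t) = (- exp (- t) * x, - exp (- t) * y, - exp (- 2 * t) * z, - t)"

lemma H_inv_mult: "H_mult (H_inv p) p = (0, 0, 0, 0)" "H_mult p (H_inv p) = (0, 0, 0, 0)"
  by (cases p; simp add: mult_exp_exp flip: mult.assoc)+

lemma group_H: "group (H_group \<mu>)"
proof (rule groupI)
  fix p assume "p \<in> carrier (H_group \<mu>)"
  show "\<exists>q\<in>carrier (H_group \<mu>). q \<otimes>\<^bsub>H_group \<mu>\<^esub> p = \<one>\<^bsub>H_group \<mu>\<^esub>"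
    using H_inv_mult(1)[of p] by (simp del: split_paired_Ex) blast
qed (auto simp: H_assoc)

lemma m_inv_H: "m_inv (H_group \<mu>) = H_inv"
proof
  fix p
  show "m_inv (H_group \<mu>) p = H_inv p"
    using group.inv_equality[OF group_H, of \<mu> "H_inv p" p] H_inv_mult[of p] by simp
qed

section \<open>Calculus of \<open>C\<^sup>k\<close> functions\<close>

lemma Ck_on_cong:
  assumes "open S" "\<And>x. x \<in> S \<Longrightarrow> f x = g x" "Ck_on k S f"
  shows "Ck_on k S g"
  using assms(2,3)
proof (induction k arbitrary: f g)
  case 0
  then show ?case using continuous_on_cong[of S S f g] by simp
next
  case (Suc k)
  have D: "(g has_derivative frechet_derivative f (at x)) (at x)" if "x \<in> S" for x
  proof (rule has_derivative_transform_within_open[OF _ \<open>open S\<close> that Suc.prems(1)])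
    show "(f has_derivative frechet_derivative f (at x)) (at x)"
      using Suc.prems(2) that by (simp flip: frechet_derivative_works)
  qed
  then have "frechet_derivative f (at x) = frechet_derivative g (at x)" if "x \<in> S" for x
    using frechet_derivative_at that by blast
  then have "Ck_on k S (\<lambda>x. frechet_derivative g (at x) v)" for v
    using Suc.IH[of "\<lambda>x. frechet_derivative f (at x) v"] Suc.prems(2) by simp
  with D show ?case
    by (auto simp: differentiable_def)
qed

lemma Ck_on_SucI:
  assumes "open S" "\<And>x. x \<in> S \<Longrightarrow> (f has_derivative f' x) (at x)"
    "\<And>v. Ck_on k S (\<lambda>x. f' x v)"
  shows "Ck_on (Suc k) S f"
proof -
  have "frechet_derivative f (at x) = f' x" if "x \<in> S" for x
    using frechet_derivative_at[OF assms(2)[OF that]] by simp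
  then have "Ck_on k S (\<lambda>x. frechet_derivative f (at x) v)" for v
    using Ck_on_cong[OF assms(1) _ assms(3)[of v]] by simp
  then show ?thesis using assms(2) by (auto simp: differentiable_def)
qed

lemma Ck_on_SucD:
  assumes "Ck_on (Suc k) S f"
  shows "x \<in> S \<Longrightarrow> (f has_derivative frechet_derivative f (at x)) (at x)"
    "Ck_on k S (\<lambda>x. frechet_derivative f (at x) v)"
  using assms by (auto simp: frechet_derivative_works)

lemma Ck_on_Suc_imp: "Ck_on (Suc k) S f \<Longrightarrow> Ck_on k S f"
proof (induction k arbitrary: f)
  case 0
  then show ?case
    by (auto intro!: continuous_at_imp_continuous_on differentiable_imp_continuous_within)
qed auto

lemma Ck_on_const: "open S \<Longrightarrow> Ck_on k S (\<lambda>_. c)"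
proof (induction k arbitrary: c)
  case (Suc k)
  show ?case by (rule Ck_on_SucI[where f'="\<lambda>_ _. 0"]) (use Suc in auto)
qed auto

lemma Ck_on_linear:
  assumes "open S" "bounded_linear f"
  shows "Ck_on k S f"
proof (cases k)
  case 0
  then show ?thesis using assms by (simp add: linear_continuous_on)
next
  case (Suc k')
  show ?thesis unfolding Suc
    by (rule Ck_on_SucI[where f'="\<lambda>_. f"])
      (use assms in \<open>auto intro: bounded_linear_imp_has_derivative Ck_on_const\<close>)
qed

lemma Ck_on_add:
  assumes "open S" "Ck_on k S f" "Ck_on k S g"
  shows "Ck_on k S (\<lambda>x. f x + g x)"
  using assms(2,3)
proof (induction k arbitrary: f g)
  case (Suc k)
  note D = Ck_on_SucD[OF Suc.prems(1)] Ck_on_SucD[OF Suc.prems(2)]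
  show ?case
    by (rule Ck_on_SucI[OF assms(1) has_derivative_add[OF D(1) D(3)]]) (auto intro: Suc.IH D)
qed (simp add: continuous_on_add continuous_on_mult continuous_on_exp continuous_on_Pair)

lemma Ck_on_mult:
  fixes f g :: "'a::euclidean_space \<Rightarrow> real"
  assumes "open S" "Ck_on k S f" "Ck_on k S g"
  shows "Ck_on k S (\<lambda>x. f x * g x)"
  using assms(2,3)
proof (induction k arbitrary: f g)
  case (Suc k)
  note D = Ck_on_SucD[OF Suc.prems(1)] Ck_on_SucD[OF Suc.prems(2)]
  show ?case
    by (rule Ck_on_SucI[OF assms(1) has_derivative_mult[OF D(1) D(3)]])
      (use Ck_on_Suc_imp[OF Suc.prems(1)] Ck_on_Suc_imp[OF Suc.prems(2)] in
        \<open>auto intro!: Ck_on_add[OF assms(1)] Suc.IH D\<close>)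
qed (simp add: continuous_on_add continuous_on_mult continuous_on_exp continuous_on_Pair)

lemma Ck_on_exp:
  fixes f :: "'a::euclidean_space \<Rightarrow> real"
  assumes "open S" "Ck_on k S f"
  shows "Ck_on k S (\<lambda>x. exp (f x))"
  using assms(2)
proof (induction k)
  case (Suc k)
  note D = Ck_on_SucD[OF Suc.prems]
  show ?case
    by (rule Ck_on_SucI[OF assms(1) has_derivative_exp[OF D(1)]])
      (use Suc.IH[OF Ck_on_Suc_imp[OF Suc.prems]] in \<open>auto intro!: Ck_on_mult[OF assms(1)] D\<close>)
qed (simp add: continuous_on_add continuous_on_mult continuous_on_exp continuous_on_Pair)

lemma Ck_on_Pair:
  assumes "open S" "Ck_on k S f" "Ck_on k S g"
  shows "Ck_on k S (\<lambda>x. (f x, g x))"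
  using assms(2,3)
proof (induction k arbitrary: f g)
  case (Suc k)
  note D = Ck_on_SucD[OF Suc.prems(1)] Ck_on_SucD[OF Suc.prems(2)]
  show ?case
    by (rule Ck_on_SucI[OF assms(1) has_derivative_Pair[OF D(1) D(3)]]) (auto intro: Suc.IH D)
qed (simp add: continuous_on_add continuous_on_mult continuous_on_exp continuous_on_Pair)

lemma bounded_linear_fst_snd:
  assumes "bounded_linear f"
  shows "bounded_linear (\<lambda>x. fst (f x))" "bounded_linear (\<lambda>x. snd (f x))"
  using assms bounded_linear_compose[OF bounded_linear_fst] bounded_linear_compose[OF bounded_linear_snd]
  by auto

section \<open>\<open>H\<close> is a sub-Riemannian Lie group with the prescribed Lie algebra\<close>

lemma H_mult_eq: "H_mult p q =
  (fst p + exp (snd (snd (snd p))) * fst q,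
   fst (snd p) + exp (snd (snd (snd p))) * fst (snd q),
   fst (snd (snd p)) + exp (2 * snd (snd (snd p))) * fst (snd (snd q))
     + (1/2) * (exp (snd (snd (snd p))) * (fst p * fst (snd q) + (-1) * (fst (snd p) * fst q))),
   snd (snd (snd p)) + snd (snd (snd q)))"
  by (cases p; cases q) simp

lemma H_inv_eq: "H_inv p =
  ((-1) * (exp ((-1) * snd (snd (snd p))) * fst p),
   (-1) * (exp ((-1) * snd (snd (snd p))) * fst (snd p)),
   (-1) * (exp ((-2) * snd (snd (snd p))) * fst (snd (snd p))),
   (-1) * snd (snd (snd p)))"
  by (cases p) simp

lemma lie_group_H: "lie_group (H_group \<mu>)"
proof -
  have 1: "smooth_on UNIV (\<lambda>(p, q). H_mult p q)"
    unfolding smooth_on_def case_prod_unfold H_mult_eq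
    by (intro allI Ck_on_Pair Ck_on_add Ck_on_mult Ck_on_exp Ck_on_const open_UNIV;
        rule Ck_on_linear; intro open_UNIV bounded_linear_fst_snd bounded_linear_ident)
  have 2: "smooth_on UNIV H_inv"
    unfolding smooth_on_def H_inv_eq[abs_def]
    by (intro allI Ck_on_Pair Ck_on_add Ck_on_mult Ck_on_exp Ck_on_const open_UNIV;
        rule Ck_on_linear; intro open_UNIV bounded_linear_fst_snd bounded_linear_ident)
  show ?thesis using 1 2 group_H by (simp add: lie_group_def m_inv_H)
qed

definition expint :: "real \<Rightarrow> real \<Rightarrow> real" where
  "expint d s = (if d = 0 then s else (exp (d * s) - 1) / d)"

lemma expint_add: "expint d (s + t) = expint d s + exp (d * s) * expint d t"
  by (simp add: expint_def field_simps exp_add)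

lemma expint_0 [simp]: "expint d 0 = 0"
  by (simp add: expint_def)

lemma expint_scale: "expint (t * d) 1 * t = expint d t"
  by (simp add: expint_def field_simps)

lemma expint_deriv: "(expint d has_real_derivative exp (d * s)) (at s)"
proof (cases "d = 0")
  case True
  then show ?thesis by (simp add: expint_def[abs_def])
next
  case False
  then show ?thesis unfolding expint_def[abs_def]
    by (auto intro!: derivative_eq_intros)
qed

fun H_sub :: "real4 \<Rightarrow> real \<Rightarrow> real4" where
  "H_sub (a, b, c, d) s = (a * expint d s, b * expint d s, c * expint (2 * d) s, d * s)"

lemma H_sub_one_parameter: "one_parameter_subgroup (H_group \<mu>) v (H_sub v)"
proof -
  obtain a b c d where v: "v = (a, b, c, d)" by (cases v)
  have "(H_sub v has_vector_derivative v) (at 0)"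
    unfolding v H_sub.simps[abs_def]
    using expint_deriv[of d 0] expint_deriv[of "2 * d" 0]
    by (auto intro!: derivative_eq_intros simp: has_real_derivative_iff_has_vector_derivative)
  then show ?thesis
    by (auto simp: one_parameter_subgroup_def v expint_add algebra_simps)
qed

lemma H_sub_unique:
  assumes "one_parameter_subgroup (H_group \<mu>) v \<gamma>"
  shows "\<gamma> = H_sub v"
proof -
  obtain a b c d where v: "v = (a, b, c, d)" by (cases v)
  define g1 where "g1 s = fst (\<gamma> s)" for s
  define g2 where "g2 s = fst (snd (\<gamma> s))" for s
  define g3 where "g3 s = fst (snd (snd (\<gamma> s)))" for s
  define g4 where "g4 s = snd (snd (snd (\<gamma> s)))" for s
  have \<gamma>: "\<gamma> s = (g1 s, g2 s, g3 s, g4 s)" for s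
    by (simp add: g1_def g2_def g3_def g4_def)
  have add: "\<gamma> (s + h) = H_mult (\<gamma> s) (\<gamma> h)" for s h
    using assms by (simp add: one_parameter_subgroup_def)
  have "(\<gamma> has_derivative (\<lambda>h. h *\<^sub>R v)) (at 0)"
    using assms by (simp add: one_parameter_subgroup_def has_vector_derivative_def)
  then have D0: "DERIV g1 0 :> a" "DERIV g2 0 :> b" "DERIV g3 0 :> c" "DERIV g4 0 :> d"
    unfolding has_field_derivative_def g1_def g2_def g3_def g4_def
    by (auto intro!: derivative_eq_intros simp: v)
  have Z0: "g1 0 = 0" "g2 0 = 0" "g3 0 = 0" "g4 0 = 0"
    using add[of 0 0] by (auto simp: \<gamma>)
  have const: "f s = f 0" if "\<And>x. DERIV f x :> 0" for f :: "real \<Rightarrow> real" and s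
    using DERIV_isconst_all[of f s 0] that by simp
  have shift: "DERIV g s :> l" if "\<And>h. g (s + h) = k h" "DERIV k 0 :> l"
    for g k :: "real \<Rightarrow> real" and s l
    using that DERIV_shift[of g l 0 s] by (simp add: add.commute[of s])
  have "DERIV g4 s :> d" for s
    by (rule shift[where k="\<lambda>h. g4 s + g4 h"])
      (use add in \<open>auto simp: \<gamma> intro!: derivative_eq_intros D0\<close>)
  then have "DERIV (\<lambda>s. g4 s - d * s) s :> 0" for s
    by (auto intro!: derivative_eq_intros)
  from const[OF this] have g4: "g4 s = d * s" for s by (simp add: Z0)
  have "DERIV g1 s :> a * exp (d * s)" for s
    by (rule shift[where k="\<lambda>h. g1 s + exp (d * s) * g1 h"])
      (use add in \<open>auto simp: \<gamma> g4 intro!: derivative_eq_intros D0\<close>)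
  then have "DERIV (\<lambda>s. g1 s - a * expint d s) s :> 0" for s
    by (auto intro!: derivative_eq_intros expint_deriv)
  from const[OF this] have g1: "g1 s = a * expint d s" for s by (simp add: Z0)
  have "DERIV g2 s :> b * exp (d * s)" for s
    by (rule shift[where k="\<lambda>h. g2 s + exp (d * s) * g2 h"])
      (use add in \<open>auto simp: \<gamma> g4 intro!: derivative_eq_intros D0\<close>)
  then have "DERIV (\<lambda>s. g2 s - b * expint d s) s :> 0" for s
    by (auto intro!: derivative_eq_intros expint_deriv)
  from const[OF this] have g2: "g2 s = b * expint d s" for s by (simp add: Z0)
  have "DERIV g3 s :> c * exp (2 * d * s)" for s
    by (rule shift[where k="\<lambda>h. g3 s + exp (2 * d * s) * g3 h"])
      (use add in \<open>auto simp: \<gamma> g4 g1 g2 intro!: derivative_eq_intros D0\<close>)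
  then have "DERIV (\<lambda>s. g3 s - c * expint (2 * d) s) s :> 0" for s
    by (auto intro!: derivative_eq_intros expint_deriv)
  from const[OF this] have g3: "g3 s = c * expint (2 * d) s" for s by (simp add: Z0)
  show ?thesis by (rule ext) (simp add: \<gamma> v g1 g2 g3 g4)
qed

lemma lie_exp_H: "lie_exp (H_group \<mu>) v = H_sub v 1"
proof -
  have "(THE \<gamma>. one_parameter_subgroup (H_group \<mu>) v \<gamma>) = H_sub v"
    using H_sub_one_parameter H_sub_unique by (rule the_equality)
  then show ?thesis by (simp add: lie_exp_def)
qed

lemma lie_exp_H_scale: "lie_exp (H_group \<mu>) (t *\<^sub>R v) = H_sub v t"
proof (cases v)
  case (fields a b c d)
  have "t * (x * expint (t * e) 1) = x * expint e t" for x e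
    using expint_scale[of t e] by (simp add: algebra_simps)
  from this[of _ d] this[of _ "2 * d"] show ?thesis
    by (simp add: lie_exp_H fields mult_ac expint_def)
qed

lemma left_field_H:
  "left_field (H_group \<mu>) (a, b, c, d) (x, y, z, t) =
     (exp t * a, exp t * b, exp (2 * t) * c + exp t * (x * b - y * a) / 2, d)"
proof -
  have "((\<lambda>s. H_mult (x, y, z, t) (H_sub (a, b, c, d) s)) has_vector_derivative
      (exp t * a, exp t * b, exp (2 * t) * c + exp t * (x * b - y * a) / 2, d)) (at 0)"
    using expint_deriv[of d 0] expint_deriv[of "2 * d" 0]
    by (auto intro!: derivative_eq_intros
        simp: has_real_derivative_iff_has_vector_derivative[symmetric])
  then show ?thesis
    unfolding left_field_def lie_exp_H_scale H_simps by (rule vector_derivative_at)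
qed

lemma lie_bracket_H:
  "lie_bracket (H_group \<mu>) (a, b, c, d) (a', b', c', d') =
     (d * a' - d' * a, d * b' - d' * b, 2 * (d * c' - d' * c) + (a * b' - b * a'), 0)"
proof -
  have D: "(left_field (H_group \<mu>) (a', b', c', d') has_derivative
      (\<lambda>(a, b, c, d). (d * a', d * b', 2 * d * c' + (a * b' - b * a') / 2, 0))) (at (0, 0, 0, 0))"
    (is "(?X has_derivative _) _") for a' b' c' d'
  proof -
    have X: "?X = (\<lambda>p. (exp (snd (snd (snd p))) * a', exp (snd (snd (snd p))) * b',
        exp (2 * snd (snd (snd p))) * c' + exp (snd (snd (snd p))) * (fst p * b' - fst (snd p) * a') / 2, d'))"
      by (auto simp: fun_eq_iff left_field_H)
    show ?thesis unfolding X
      by (auto intro!: derivative_eq_intros simp: fun_eq_iff)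
  qed
  show ?thesis
    using frechet_derivative_at[OF D, of a b c d, symmetric]
      frechet_derivative_at[OF D, of a' b' c' d', symmetric]
    by (simp add: lie_bracket_def field_simps)
qed

lemma H_brackets:
  "lie_bracket (H_group \<mu>) Y1 Y2 = Z" "lie_bracket (H_group \<mu>) Y3 Y1 = Y1"
  "lie_bracket (H_group \<mu>) Y3 Y2 = Y2" "lie_bracket (H_group \<mu>) Y3 Z = 2 *\<^sub>R Z"
  "lie_bracket (H_group \<mu>) Y1 Z = 0" "lie_bracket (H_group \<mu>) Y2 Z = 0"
  by (simp_all add: Y1_def Y2_def Y3_def Z_def lie_bracket_H zero_prod_def)

lemma scalar_product_on_inner: "scalar_product_on V (\<bullet>)"
  by (auto simp: scalar_product_on_def inner_add_left inner_add_right inner_commute)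

lemma sub_riemannian_lie_group_H:
  assumes "left_haar_measure (H_group \<mu>) \<mu>"
  shows "sub_riemannian_lie_group (H_group \<mu>)"
proof -
  let ?P = "\<lambda>W. subspace W \<and> (\<forall>v\<in>W. \<forall>w\<in>W. lie_bracket (H_group \<mu>) v w \<in> W)"
  have "v \<in> W" if W: "?P W" "span {Y1, Y2, Y3} \<subseteq> W" for W v
  proof -
    obtain a b c d where v: "v = (a, b, c, d)" by (cases v)
    have Y: "Y1 \<in> W" "Y2 \<in> W" "Y3 \<in> W" using W(2) by (meson insertCI span_base subsetD)+
    then have "lie_bracket (H_group \<mu>) Y1 Y2 \<in> W" using W(1) by blast
    then have "Z \<in> W" by (simp only: H_brackets)
    with Y W(1) have "a *\<^sub>R Y1 + b *\<^sub>R Y2 + c *\<^sub>R Z + d *\<^sub>R Y3 \<in> W"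
      by (intro subspace_add subspace_scale) auto
    then show ?thesis by (simp add: v Y1_def Y2_def Y3_def Z_def)
  qed
  then have "?P hull span {Y1, Y2, Y3} = UNIV"
    unfolding hull_def by blast
  moreover note scalar_product_on_inner[of "span {Y1, Y2, Y3}"]
  ultimately show ?thesis
    using assms by (simp add: sub_riemannian_lie_group_def lie_group_H)
qed

lemma orthonormal_basis_H: "orthonormal_basis (H_group \<mu>) {Y1, Y2, Y3}"
proof -
  have "\<forall>v\<in>{Y1, Y2, Y3}. \<forall>w\<in>{Y1, Y2, Y3}. v \<bullet> w = (if v = w then 1 else 0)"
    by (simp add: Y1_def Y2_def Y3_def)
  then show ?thesis by (simp add: orthonormal_basis_def)
qed

end

theory Submission
  imports Defs
begin

text \<open>
  The identity has Lie differential \<open>id\<close> at every point, so it is conformal of factor \<open>1\<close>, its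
  second derivative vanishes, and the two modular terms of the tension field cancel. It pulls
  harmonic functions back to their restrictions, which are harmonic because a test function
  supported in the smaller set is also one for the larger set.

  For the energy, observe that in the chart \<open>(x, y, z, t)\<close> the polarization is spanned by \<open>\<partial>\<^sub>t\<close> and by
  \<open>e\<^sup>t (\<partial>\<^sub>x - y/2 \<partial>\<^sub>z)\<close>, \<open>e\<^sup>t (\<partial>\<^sub>y + x/2 \<partial>\<^sub>z)\<close>. It is the kernel of the one-form \<open>dz - (x dy - y dx)/2\<close>, in
  which \<open>t\<close> does not occur. Hence every \<open>C\<^sup>1\<close> map that changes only the coordinate \<open>t\<close> is a contact
  map, and each bump function \<open>\<phi> \<ge> 0\<close> on \<open>\<Omega>\<close> gives a contact variation
  \<open>F\<^sub>s(x, y, z, t) = (x, y, z, t - s \<phi>)\<close> of the identity. Its energy density is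
  \<open>2 exp (2 s \<phi>) + (s Y\<^sub>1\<phi>)\<^sup>2 + (s Y\<^sub>2\<phi>)\<^sup>2 + (1 - s Y\<^sub>3\<phi>)\<^sup>2\<close> (lemma \<open>density\<close>): pushing \<open>Y\<^sub>1\<close> and \<open>Y\<^sub>2\<close> down by
  \<open>s \<phi>\<close> rescales them by \<open>exp (s \<phi>)\<close>. The derivative of the energy at \<open>s = 0\<close> is therefore the
  integral of \<open>2 \<phi> - Y\<^sub>3\<phi>\<close>.

  The group is not unimodular: \<open>tr ad Y\<^sub>3 = 4\<close>, and the integral of \<open>Y\<^sub>3\<phi>\<close> is not zero but four times
  the integral of \<open>\<phi>\<close> (lemma \<open>has_bochner_integral_vertical_derivative\<close>). So the energy has the
  derivative \<open>- 2 \<integral> \<phi> < 0\<close> (lemma \<open>energy_has_derivative\<close>), which shows both that the identity is not a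
  harmonic map and that the energy decreases strictly along the variation.
\<close>

section \<open>Orthonormal bases and integrals over compact sets\<close>

lemma Parseval:
  fixes w :: "'a::euclidean_space"
  assumes "finite B" "\<forall>v\<in>B. \<forall>w\<in>B. v \<bullet> w = (if v = w then 1 else 0)" "w \<in> span B"
  shows "(\<Sum>X\<in>B. (X \<bullet> w)\<^sup>2) = w \<bullet> w"
proof -
  obtain u where w: "w = (\<Sum>v\<in>B. u v *\<^sub>R v)"
    using assms(1,3) by (auto simp: span_finite)
  have "X \<bullet> w = u X" if "X \<in> B" for X
    using that assms(1,2) unfolding w inner_sum_right
    by (simp add: if_distrib[of "\<lambda>x. _ * x"] cong: if_cong)
  then show ?thesis
    unfolding inner_sum_left[of _ B w] w inner_sum_left
    by (simp add: power2_eq_square flip: w)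
qed

lemma set_integrable_continuous_on_compact:
  fixes f :: "'a::euclidean_space \<Rightarrow> real"
  assumes M: "sets M = sets borel" and K: "compact K" "emeasure M K < \<infinity>"
    and f: "continuous_on K f"
  shows "set_integrable M K f"
proof -
  have Kb: "K \<in> sets borel" using K(1) by (simp add: borel_compact)
  obtain C where C: "\<And>p. p \<in> K \<Longrightarrow> norm (f p) \<le> C"
    using compact_imp_bounded[OF compact_continuous_image[OF f K(1)]]
    by (auto simp: bounded_iff)
  have "(\<lambda>p. indicator K p *\<^sub>R f p) \<in> borel_measurable M"
    using borel_measurable_continuous_on_indicator[OF Kb f] measurable_cong_sets[OF M refl] by blast
  then show ?thesis
    unfolding set_integrable_def
    by (rule integrableI_bounded_set[where A=K and B=C, rotated])
      (use K Kb C M in \<open>auto\<close>)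
qed

text \<open>
  Differentiation under the integral sign: by the mean value theorem the difference quotients
  are bounded by the maximum of \<open>f'\<close> on the compact set \<open>{-e..e} \<times> K\<close>, so dominated convergence
  applies.
\<close>

lemma has_real_derivative_set_integral_compact:
  fixes f f' :: "real \<Rightarrow> 'a::euclidean_space \<Rightarrow> real"
  assumes M: "sets M = sets borel" and K: "compact K" "emeasure M K < \<infinity>" and e: "e > 0"
    and cont: "\<And>s. \<bar>s\<bar> \<le> e \<Longrightarrow> continuous_on K (f s)"
    and deriv: "\<And>s p. \<bar>s\<bar> \<le> e \<Longrightarrow> p \<in> K \<Longrightarrow> ((\<lambda>s. f s p) has_real_derivative f' s p) (at s)"
    and cont': "continuous_on ({-e..e} \<times> K) (\<lambda>(s, p). f' s p)"
  shows "((\<lambda>s. LINT p:K|M. f s p) has_real_derivative (LINT p:K|M. f' 0 p)) (at 0)"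
proof -
  note int = set_integrable_continuous_on_compact[OF M K]
  have cont'0: "continuous_on K (f' 0)"
    using continuous_on_compose2[OF cont', of K "\<lambda>p. (0, p)"] e by (force intro!: continuous_intros)
  obtain C where C: "\<And>s p. \<bar>s\<bar> \<le> e \<Longrightarrow> p \<in> K \<Longrightarrow> \<bar>f' s p\<bar> \<le> C"
    using compact_imp_bounded[OF compact_continuous_image[OF cont' compact_Times[OF compact_Icc K(1)]]]
    by (force simp: bounded_iff)
  \<comment> \<open>The difference quotient, replaced by its limit for increments outside the range of \<open>deriv\<close>.\<close>
  define q where "q h p = (if \<bar>h\<bar> \<le> e then (f h p - f 0 p) / h else f' 0 p)" for h p
  have q_bound: "\<bar>q h p\<bar> \<le> C" if h: "h \<noteq> 0" and p: "p \<in> K" for h p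
  proof (cases "\<bar>h\<bar> \<le> e")
    case True
    have "\<exists>z. \<bar>z\<bar> \<le> e \<and> f h p - f 0 p = h * f' z p"
    proof (cases "h > 0")
      case True
      then have "\<exists>z. 0 < z \<and> z < h \<and> f h p - f 0 p = (h - 0) * f' z p"
        by (intro MVT2 deriv p) (use \<open>\<bar>h\<bar> \<le> e\<close> in auto)
      then show ?thesis using \<open>\<bar>h\<bar> \<le> e\<close> by force
    next
      case False
      then have "\<exists>z. h < z \<and> z < 0 \<and> f 0 p - f h p = (0 - h) * f' z p"
        by (intro MVT2 deriv p) (use \<open>\<bar>h\<bar> \<le> e\<close> h in auto)
      then obtain z where "h < z" "z < 0" "f 0 p - f h p = (0 - h) * f' z p" by blast
      then show ?thesis using \<open>\<bar>h\<bar> \<le> e\<close> by (intro exI[of _ z]) auto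
    qed
    then obtain z where "\<bar>z\<bar> \<le> e" "f h p - f 0 p = h * f' z p" by blast
    then show ?thesis using h True p C[of z] by (simp add: q_def)
  next
    case False
    then show ?thesis using C[of 0] e p by (simp add: q_def)
  qed
  have q_cont: "continuous_on K (q h)" for h
  proof (cases "\<bar>h\<bar> \<le> e")
    case True
    then show ?thesis
      using cont[OF True] cont[of 0] e by (cases "h = 0") (auto simp: q_def[abs_def] intro!: continuous_intros)
  qed (simp add: q_def[abs_def] cont'0)
  have small: "\<forall>\<^sub>F h in at 0. \<bar>h\<bar> \<le> e \<and> h \<noteq> 0"
    unfolding eventually_at using e by (intro exI[of _ e]) auto
  have q_lim: "((\<lambda>h. q h p) \<longlongrightarrow> f' 0 p) (at 0)" if "p \<in> K" for p
  proof -
    have "((\<lambda>h. (f h p - f 0 p) / (h - 0)) \<longlongrightarrow> f' 0 p) (at 0)"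
      using deriv[of 0 p] that e by (simp add: has_field_derivative_iff)
    then show ?thesis
      by (rule Lim_transform_eventually) (use small in \<open>auto elim!: eventually_mono simp: q_def\<close>)
  qed
  have "((\<lambda>h. LINT p:K|M. q h p) \<longlongrightarrow> (LINT p:K|M. f' 0 p)) (at 0)"
    unfolding tendsto_at_iff_sequentially comp_def
  proof (intro allI impI)
    fix X :: "nat \<Rightarrow> real" assume X: "\<forall>i. X i \<in> UNIV - {0}" "X \<longlonglongrightarrow> 0"
    show "(\<lambda>i. LINT p:K|M. q (X i) p) \<longlonglongrightarrow> (LINT p:K|M. f' 0 p)"
      unfolding set_lebesgue_integral_def
    proof (rule integral_dominated_convergence[where w="\<lambda>p. indicator K p *\<^sub>R C"])
      show "(\<lambda>p. indicator K p *\<^sub>R f' 0 p) \<in> borel_measurable M"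
        using int[OF cont'0] by (auto simp: set_integrable_def)
      show "(\<lambda>p. indicator K p *\<^sub>R q (X i) p) \<in> borel_measurable M" for i
        using int[OF q_cont] by (auto simp: set_integrable_def)
      show "integrable M (\<lambda>p. indicator K p *\<^sub>R C)"
        using int[of "\<lambda>_. C"] by (auto simp: set_integrable_def)
      show "AE p in M. (\<lambda>i. indicator K p *\<^sub>R q (X i) p) \<longlonglongrightarrow> indicator K p *\<^sub>R f' 0 p"
      proof (rule AE_I2)
        fix p
        have "(\<lambda>i. q (X i) p) \<longlonglongrightarrow> f' 0 p" if "p \<in> K"
          using q_lim[OF that] X unfolding tendsto_at_iff_sequentially comp_def by blast
        then show "(\<lambda>i. indicator K p *\<^sub>R q (X i) p) \<longlonglongrightarrow> indicator K p *\<^sub>R f' 0 p"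
          by (cases "p \<in> K") auto
      qed
      show "AE p in M. norm (indicator K p *\<^sub>R q (X i) p) \<le> indicator K p *\<^sub>R C" for i
        using q_bound[of "X i"] X by (intro AE_I2) (auto simp: indicator_def)
    qed
  qed
  moreover have "(LINT p:K|M. q h p) = ((LINT p:K|M. f h p) - (LINT p:K|M. f 0 p)) / (h - 0)"
    if "\<bar>h\<bar> \<le> e" for h
    using that e int[OF cont] by (simp add: q_def)
  then have "\<forall>\<^sub>F h in at 0. (LINT p:K|M. q h p) = ((LINT p:K|M. f h p) - (LINT p:K|M. f 0 p)) / (h - 0)"
    using small by (auto elim!: eventually_mono)
  ultimately show ?thesis
    unfolding has_field_derivative_iff by (rule Lim_transform_eventually)
qed

lemma set_integral_eq_integral_support:
  fixes f :: "'a \<Rightarrow> real"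
  assumes "\<And>p. p \<notin> K \<Longrightarrow> f p = 0"
  shows "(LINT p:K|M. f p) = (LINT p|M. f p)" "set_integrable M K f \<longleftrightarrow> integrable M f"
proof -
  have "(\<lambda>p. indicator K p *\<^sub>R f p) = f"
    by (rule ext) (use assms in \<open>auto simp: indicator_def\<close>)
  then show "(LINT p:K|M. f p) = (LINT p|M. f p)" "set_integrable M K f \<longleftrightarrow> integrable M f"
    by (simp_all add: set_lebesgue_integral_def set_integrable_def)
qed

lemma frechet_derivative_eq_0_off_support:
  fixes \<phi> :: "'a::euclidean_space \<Rightarrow> real"
  assumes "compact K" "\<And>p. p \<notin> K \<Longrightarrow> \<phi> p = 0" "p \<notin> K"
  shows "frechet_derivative \<phi> (at p) v = 0"
proof -
  have "open (- K)" using assms(1) by (simp add: compact_imp_closed open_Compl)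
  have "(\<phi> has_derivative (\<lambda>_. 0)) (at p)"
    by (rule has_derivative_transform_within_open[OF has_derivative_const \<open>open (- K)\<close>])
      (use assms in auto)
  from frechet_derivative_at[OF this] show ?thesis by (metis)
qed

lemma Ck_on_1_has_derivative:
  "Ck_on 1 S f \<Longrightarrow> x \<in> S \<Longrightarrow> (f has_derivative frechet_derivative f (at x)) (at x)"
  using Ck_on_SucD(1)[of 0 S f x] by simp

text \<open>
  Continuity holds jointly in the base point and the direction, since the derivative is a
  finite sum of partial derivatives weighted by the coordinates of the direction.
\<close>

lemma continuous_on_frechet_derivative:
  fixes \<phi> :: "'a::euclidean_space \<Rightarrow> real"
  assumes "Ck_on 1 UNIV \<phi>" "continuous_on S f" "continuous_on S g"
  shows "continuous_on S (\<lambda>x. frechet_derivative \<phi> (at (f x)) (g x))"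
proof -
  have D: "(\<phi> has_derivative frechet_derivative \<phi> (at p)) (at p)" for p
    using Ck_on_1_has_derivative[OF assms(1)] by simp
  have expand: "frechet_derivative \<phi> (at p) v = (\<Sum>b\<in>Basis. (v \<bullet> b) * frechet_derivative \<phi> (at p) b)" for p v
  proof -
    interpret linear "frechet_derivative \<phi> (at p)" using D has_derivative_linear by blast
    show ?thesis
      by (subst euclidean_representation[of v, symmetric]) (simp only: sum scale real_scaleR_def)
  qed
  have "continuous_on UNIV (\<lambda>p. frechet_derivative \<phi> (at p) b)" for b
    using assms(1) by simp
  then have "continuous_on S (\<lambda>x. frechet_derivative \<phi> (at (f x)) b)" for b
    by (rule continuous_on_compose2[OF _ assms(2)]) auto
  then have "continuous_on S (\<lambda>x. \<Sum>b\<in>Basis. (g x \<bullet> b) * frechet_derivative \<phi> (at (f x)) b)"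
    by (intro continuous_intros assms)
  then show ?thesis by (simp only: expand[symmetric])
qed

section \<open>Smooth bump functions\<close>

text \<open>
  The family \<open>x\<^sup>-\<^sup>n exp (- 1/x)\<close>, extended by \<open>0\<close> to \<open>x \<le> 0\<close>, contains the usual flat function as \<open>flat 0\<close>,
  and the derivative of each member is a linear combination of later members. This closure
  is what lets the induction on the order of differentiability go through.
\<close>

definition flat :: "nat \<Rightarrow> real \<Rightarrow> real" where
  "flat n x = (if x > 0 then (1 / x) ^ n * exp (- (1 / x)) else 0)"

lemma flat_tendsto_0: "(flat n \<longlongrightarrow> 0) (at 0)"
proof -
  have "((\<lambda>y::real. y ^ n / exp y) \<longlongrightarrow> 0) at_top"
    by (rule tendsto_power_div_exp_0)
  then have "((\<lambda>x::real. inverse x ^ n / exp (inverse x)) \<longlongrightarrow> 0) (at_right 0)"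
    by (rule filterlim_compose) (rule filterlim_inverse_at_top_right)
  moreover have "\<forall>\<^sub>F x::real in at_right 0. inverse x ^ n / exp (inverse x) = flat n x"
    unfolding eventually_at_right_field
    by (intro exI[of _ 1]) (auto simp: flat_def exp_minus field_simps)
  ultimately have R: "(flat n \<longlongrightarrow> 0) (at_right 0)"
    by (rule Lim_transform_eventually)
  have "\<forall>\<^sub>F x::real in at_left 0. 0 = flat n x"
    unfolding eventually_at_left_field
    by (intro exI[of _ "-1"]) (auto simp: flat_def)
  then have "(flat n \<longlongrightarrow> 0) (at_left 0)"
    by (rule Lim_transform_eventually[OF tendsto_const])
  with R show ?thesis by (simp add: filterlim_split_at)
qed

lemma flat_deriv: "(flat n has_real_derivative flat (n + 2) x - n * flat (Suc n) x) (at x)"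
proof -
  consider "x < 0" | "x = 0" | "x > 0" by linarith
  then show ?thesis
  proof cases
    case 1
    have "((\<lambda>_. 0) has_real_derivative 0) (at x)" by simp
    then have "(flat n has_real_derivative 0) (at x)"
      by (rule has_field_derivative_transform_within_open[where S="{..<0}"])
        (use 1 in \<open>auto simp: flat_def\<close>)
    then show ?thesis using 1 by (simp add: flat_def)
  next
    case 2
    have "(\<lambda>y. (flat n y - flat n 0) / (y - 0)) = flat (Suc n)"
      by (rule ext) (simp add: flat_def)
    then have "(flat n has_real_derivative 0) (at 0)"
      using flat_tendsto_0[of "Suc n"] by (simp only: has_field_derivative_iff)
    then show ?thesis using 2 by (simp add: flat_def)
  next
    case 3
    have "((\<lambda>x. (1 / x) ^ n * exp (- (1 / x))) has_real_derivative
        flat (n + 2) x - n * flat (Suc n) x) (at x)"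
    proof (cases n)
      case 0
      then show ?thesis
        using 3 by (auto intro!: derivative_eq_intros simp: flat_def field_simps power2_eq_square)
    next
      case (Suc m)
      have "m = 0 \<or> x * x ^ (m - Suc 0) = x ^ m" by (cases m) auto
      then show ?thesis
        using 3 Suc by (auto intro!: derivative_eq_intros simp: flat_def field_simps power2_eq_square)
    qed
    then show ?thesis
      by (rule has_field_derivative_transform_within_open[where S="{0<..}"])
        (use 3 in \<open>auto simp: flat_def\<close>)
  qed
qed

lemma Ck_on_flat:
  assumes "open S" "Ck_on k S q"
  shows "Ck_on k S (\<lambda>x. flat n (q x))"
  using assms(2)
proof (induction k arbitrary: n)
  case 0
  have "isCont (flat n) x" for x using flat_deriv by (rule DERIV_isCont)
  then have "continuous_on UNIV (flat n)" by (simp add: continuous_on_eq_continuous_at)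
  then show ?case using 0 by (auto intro: continuous_on_compose2)
next
  case (Suc k)
  note D = Ck_on_SucD[OF Suc.prems]
  note IH = Suc.IH[OF Ck_on_Suc_imp[OF Suc.prems]]
  have der: "((\<lambda>x. flat n (q x)) has_derivative
      (\<lambda>v. (flat (n + 2) (q x) + (- real n) * flat (Suc n) (q x)) * frechet_derivative q (at x) v)) (at x)"
    if "x \<in> S" for x
    using has_derivative_compose[OF D(1)[OF that] flat_deriv[of n "q x", unfolded has_field_derivative_def]]
    by (simp add: mult.commute)
  show ?case
    by (rule Ck_on_SucI[OF assms(1) der]; (assumption | intro Ck_on_mult Ck_on_add Ck_on_const assms(1) IH D(2))?)
qed

lemma Ck_on_compose_linear:
  fixes f :: "'a::euclidean_space \<Rightarrow> 'b::euclidean_space"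
  assumes "open S" "bounded_linear f" "Ck_on k UNIV g"
  shows "Ck_on k S (\<lambda>x. g (f x))"
  using assms(3)
proof (induction k arbitrary: g)
  case 0
  then show ?case
    by (auto intro: continuous_on_compose2 linear_continuous_on[OF assms(2)])
next
  case (Suc k)
  note D = Ck_on_SucD[OF Suc.prems]
  have "((\<lambda>x. g (f x)) has_derivative (\<lambda>v. frechet_derivative g (at (f x)) (f v))) (at x)" for x
    using has_derivative_compose[OF bounded_linear_imp_has_derivative[OF assms(2)] D(1)[OF UNIV_I]] .
  then show ?case
    by (rule Ck_on_SucI[OF assms(1)]) (rule Suc.IH[OF D(2)])
qed

lemma smooth_bump:
  fixes \<Omega> :: "'a::euclidean_space set"
  assumes "open \<Omega>" "\<Omega> \<noteq> {}"
  obtains \<phi> :: "'a \<Rightarrow> real" and K where "smooth_on UNIV \<phi>" "compact K" "K \<subseteq> \<Omega>"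
    "\<And>p. p \<notin> K \<Longrightarrow> \<phi> p = 0" "\<And>p. \<phi> p \<ge> 0" "\<exists>p. \<phi> p > 0"
proof -
  obtain c where "c \<in> \<Omega>" using assms(2) by blast
  then obtain r where r: "r > 0" "cball c r \<subseteq> \<Omega>" using assms(1) open_contains_cball by blast
  define q where "q x = r\<^sup>2 - (x - c) \<bullet> (x - c)" for x
  have "Ck_on k UNIV q" for k
  proof (cases k)
    case 0
    then show ?thesis by (auto simp: q_def[abs_def] intro!: continuous_intros)
  next
    case (Suc k')
    have "(q has_derivative (\<lambda>v. x \<bullet> (- 2 *\<^sub>R v) + 2 * (c \<bullet> v))) (at x)" for x
      unfolding q_def[abs_def]
      by (auto intro!: derivative_eq_intros simp: inner_diff_left inner_diff_right inner_commute algebra_simps)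
    then show ?thesis
      unfolding Suc by (rule Ck_on_SucI[OF open_UNIV])
        (intro Ck_on_add Ck_on_const Ck_on_linear open_UNIV bounded_linear_inner_left)
  qed
  then have smooth: "smooth_on UNIV (\<lambda>x. flat 0 (q x))"
    unfolding smooth_on_def by (intro allI Ck_on_flat open_UNIV)
  have off: "flat 0 (q x) = 0" if "x \<notin> cball c r" for x
  proof -
    have "r < norm (x - c)" using that by (simp add: dist_norm norm_minus_commute)
    then have "r\<^sup>2 \<le> (norm (x - c))\<^sup>2" using r(1) by (intro power_mono) auto
    then show ?thesis by (simp add: flat_def q_def power2_norm_eq_inner)
  qed
  have "flat 0 (q c) > 0" using r(1) by (simp add: flat_def q_def)
  then have pos: "\<exists>x. flat 0 (q x) > 0" by blast
  show ?thesis
    by (rule that[OF smooth compact_cball r(2) off _ pos]) (simp_all add: flat_def)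
qed

section \<open>Left Haar measures of \<open>H\<close>\<close>

lemma continuous_on_H_mult:
  "continuous_on S f \<Longrightarrow> continuous_on S g \<Longrightarrow> continuous_on S (\<lambda>x. H_mult (f x) (g x))"
  unfolding H_mult_eq by (intro continuous_intros)

lemma continuous_on_H_inv: "continuous_on S f \<Longrightarrow> continuous_on S (\<lambda>x. H_inv (f x))"
  unfolding H_inv_eq by (intro continuous_intros)

lemma H_inv_cancel: "H_mult (H_inv g) (H_mult g p) = p" "H_mult g (H_mult (H_inv g) p) = p"
proof -
  have "H_mult (0, 0, 0, 0) p = p" by (cases p) simp
  then show "H_mult (H_inv g) (H_mult g p) = p" "H_mult g (H_mult (H_inv g) p) = p"
    using H_inv_mult by (simp_all flip: H_assoc)
qed

lemma H_inv_H_inv: "H_inv (H_inv p) = p"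
  by (cases p) (simp add: exp_minus)

lemma left_translation_image_eq_vimage: "H_mult g ` A = H_mult (H_inv g) -` A"
proof (rule Set.set_eqI, rule iffI)
  fix p assume "p \<in> H_mult g ` A"
  then obtain q where "p = H_mult g q" "q \<in> A" by (rule imageE)
  then show "p \<in> H_mult (H_inv g) -` A" by (simp only: vimage_eq H_inv_cancel)
next
  fix p assume "p \<in> H_mult (H_inv g) -` A"
  then have "H_mult g (H_mult (H_inv g) p) \<in> H_mult g ` A" by (intro imageI) (simp only: vimage_eq)
  then show "p \<in> H_mult g ` A" by (simp only: H_inv_cancel)
qed

context
  fixes \<mu> :: "real4 measure"
  assumes haar: "left_haar_measure (H_group \<mu>) \<mu>"
begin

lemma sets_haar: "sets \<mu> = sets borel" and space_haar: "space \<mu> = UNIV"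
  and haar_compact: "compact K \<Longrightarrow> emeasure \<mu> K < \<infinity>"
  using haar sets_eq_imp_space_eq[of \<mu> borel] by (auto simp: left_haar_measure_def)

lemma emeasure_left_translation: "A \<in> sets borel \<Longrightarrow> emeasure \<mu> (H_mult g ` A) = emeasure \<mu> A"
  using haar unfolding left_haar_measure_def H_simps by blast

lemma measurable_left_translation: "H_mult g \<in> measurable \<mu> borel"
  using borel_measurable_continuous_onI[OF continuous_on_H_mult[OF continuous_on_const continuous_on_id]]
    measurable_cong_sets[OF sets_haar refl] by blast

lemma distr_left_translation: "distr \<mu> borel (H_mult g) = \<mu>"
proof (rule measure_eqI)
  fix A assume "A \<in> sets (distr \<mu> borel (H_mult g))"
  then have A: "A \<in> sets borel" by simp
  have "H_mult g -` A = H_mult (H_inv g) ` A"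
    by (simp only: left_translation_image_eq_vimage H_inv_H_inv)
  then show "emeasure (distr \<mu> borel (H_mult g)) A = emeasure \<mu> A"
    using A by (simp add: emeasure_distr measurable_left_translation space_haar emeasure_left_translation)
qed (simp add: sets_haar)

text \<open>
  Countably many left translates of \<open>U\<close> cover the group by Lindeloef's theorem, so a null set
  \<open>U\<close> would make the whole measure vanish.
\<close>

lemma emeasure_haar_open_pos:
  assumes "open U" "U \<noteq> {}"
  shows "emeasure \<mu> U > 0"
proof (rule ccontr)
  assume "\<not> emeasure \<mu> U > 0"
  then have 0: "emeasure \<mu> (H_mult g ` U) = 0" for g
    using assms(1) by (simp add: emeasure_left_translation)
  have op: "open (H_mult g ` U)" for g
    unfolding left_translation_image_eq_vimage
    by (intro open_vimage assms continuous_on_H_mult continuous_intros)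
  obtain \<F> where \<F>: "\<F> \<subseteq> range (\<lambda>g. H_mult g ` U)" "countable \<F>"
      "\<Union>\<F> = \<Union>(range (\<lambda>g. H_mult g ` U))"
    using Lindelof[of "range (\<lambda>g. H_mult g ` U)"] op by blast
  obtain u where u: "u \<in> U" using assms(2) by blast
  have "p \<in> \<Union>\<F>" for p
  proof -
    have "p = H_mult (H_mult p (H_inv u)) u"
      using H_inv_mult(1)[of u] by (cases p) (simp add: H_assoc)
    then show ?thesis unfolding \<F>(3) using u by blast
  qed
  then have "\<Union>\<F> = UNIV" by blast
  moreover have "A \<in> null_sets \<mu>" if "A \<in> \<F>" for A
  proof -
    from \<F>(1) that have "A \<in> range (\<lambda>g. H_mult g ` U)" by (rule subsetD)
    then obtain g where "A = H_mult g ` U" by (rule imageE)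
    with 0[of g] op[of g] show ?thesis by (simp add: null_sets_def sets_haar)
  qed
  then have "\<Union>\<F> \<in> null_sets \<mu>"
    using null_sets_UN'[OF \<F>(2), of "\<lambda>A. A" \<mu>] by simp
  ultimately show False using haar by (auto simp: left_haar_measure_def null_sets_def)
qed

lemma integrable_continuous_compact_support:
  fixes f :: "real4 \<Rightarrow> real"
  assumes "continuous_on UNIV f" "compact K" "\<And>p. p \<notin> K \<Longrightarrow> f p = 0"
  shows "integrable \<mu> f"
proof -
  have "set_integrable \<mu> K f"
    by (rule set_integrable_continuous_on_compact[OF sets_haar assms(2) haar_compact[OF assms(2)]
          continuous_on_subset[OF assms(1) subset_UNIV]])
  then show ?thesis
    using set_integral_eq_integral_support(2)[of K f \<mu>, OF assms(3)] by (rule iffD1[rotated])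
qed

text \<open>
  Left translations preserve the Haar measure, so the integral of \<open>\<phi> (g h p)\<close> over \<open>p\<close> does not
  depend on \<open>h\<close>; the claim is its derivative at \<open>h = 0\<close>, taken under the integral sign. The field \<open>R 0\<close>
  is right-invariant, as right translations commute with left ones.
\<close>

lemma integral_right_invariant_derivative:
  fixes \<phi> :: "real4 \<Rightarrow> real"
  assumes \<phi>: "Ck_on 1 UNIV \<phi>" and K: "compact K" and supp: "\<And>p. p \<notin> K \<Longrightarrow> \<phi> p = 0"
    and g: "continuous_on UNIV g" "g 0 = (0, 0, 0, 0)"
    and R: "\<And>h p. ((\<lambda>h. H_mult (g h) p) has_vector_derivative R h p) (at h)"
      "continuous_on UNIV (\<lambda>(h, p). R h p)"
  shows "has_bochner_integral \<mu> (\<lambda>p. frechet_derivative \<phi> (at p) (R 0 p)) 0"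
proof -
  have D: "(\<phi> has_derivative frechet_derivative \<phi> (at p)) (at p)" for p
    using Ck_on_1_has_derivative[OF \<phi>] by simp
  have c\<phi>: "continuous_on UNIV \<phi>"
    by (intro continuous_at_imp_continuous_on ballI has_derivative_continuous[OF D])
  have cg: "continuous_on S (\<lambda>x. g (f x))" if "continuous_on S f" for S :: "'b::topological_space set" and f
    by (rule continuous_on_compose2[OF g(1) that]) simp
  \<comment> \<open>A compact set that contains the supports of all translates of \<open>\<phi>\<close> by \<open>g h\<close>, \<open>\<bar>h\<bar> \<le> 1\<close>.\<close>
  define K' where "K' = (\<lambda>(h, q). H_mult (H_inv (g h)) q) ` ({-1..1} \<times> K)"
  have K': "compact K'"
    unfolding K'_def case_prod_unfold
    by (intro compact_continuous_image compact_Times compact_Icc K continuous_on_H_mult continuous_on_H_inv cg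
        continuous_intros)
  define f where "f h p = \<phi> (H_mult (g h) p)" for h p
  define f' where "f' h p = frechet_derivative \<phi> (at (H_mult (g h) p)) (R h p)" for h p
  have supp': "f h p = 0" if "\<bar>h\<bar> \<le> 1" "p \<notin> K'" for h p
  proof -
    have "H_mult (g h) p \<notin> K"
    proof
      assume "H_mult (g h) p \<in> K"
      with that(1) have "(\<lambda>(h, q). H_mult (H_inv (g h)) q) (h, H_mult (g h) p) \<in> K'"
        unfolding K'_def by (intro imageI) auto
      with that(2) show False by (simp add: H_inv_cancel)
    qed
    then show ?thesis by (simp add: f_def supp)
  qed
  have const: "(LINT p:K'|\<mu>. f h p) = (LINT p|\<mu>. \<phi> p)" if "\<bar>h\<bar> \<le> 1" for h
  proof -
    have "(LINT p:K'|\<mu>. f h p) = (LINT p|\<mu>. f h p)"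
      using supp'[OF that] by (rule set_integral_eq_integral_support)
    also have "\<dots> = (LINT p|distr \<mu> borel (H_mult (g h)). \<phi> p)"
      unfolding f_def
      by (rule integral_distr[symmetric, OF measurable_left_translation borel_measurable_continuous_onI[OF c\<phi>]])
    finally show ?thesis by (simp only: distr_left_translation)
  qed
  have "((\<lambda>h. LINT p:K'|\<mu>. f h p) has_real_derivative (LINT p:K'|\<mu>. f' 0 p)) (at 0)"
  proof (rule has_real_derivative_set_integral_compact[OF sets_haar K' haar_compact[OF K'] zero_less_one])
    show "continuous_on K' (f h)" for h
      unfolding f_def by (intro continuous_on_compose2[OF c\<phi>] continuous_on_H_mult continuous_intros) auto
    show "((\<lambda>h. f h p) has_real_derivative f' h p) (at h)" for h p
      using vector_derivative_diff_chain_within[OF R(1) has_derivative_at_withinI[OF D]]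
      unfolding f_def f'_def comp_def has_real_derivative_iff_has_vector_derivative .
    have "continuous_on ({- 1..1} \<times> K') (\<lambda>x. frechet_derivative \<phi> (at (H_mult (g (fst x)) (snd x))) ((\<lambda>(h, p). R h p) x))"
      by (intro continuous_on_frechet_derivative[OF \<phi>] continuous_on_H_mult cg continuous_intros
          continuous_on_subset[OF R(2)]) auto
    then show "continuous_on ({- 1..1} \<times> K') (\<lambda>(h, p). f' h p)"
      unfolding f'_def by (simp add: case_prod_unfold)
  qed
  moreover have "((\<lambda>h. LINT p:K'|\<mu>. f h p) has_real_derivative 0) (at 0)"
    by (rule has_field_derivative_transform_within_open[OF DERIV_const, where S="{-1<..<1}"]) (auto simp: const)
  ultimately have 0: "(LINT p:K'|\<mu>. f' 0 p) = 0" by (rule DERIV_unique)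
  have f'0: "f' 0 p = frechet_derivative \<phi> (at p) (R 0 p)" for p
  proof -
    have "H_mult (g 0) p = p" unfolding g(2) by (cases p) simp
    then show ?thesis by (simp add: f'_def)
  qed
  have off: "f' 0 p = 0" if "p \<notin> K" for p
    unfolding f'0 using K supp that by (rule frechet_derivative_eq_0_off_support)
  have KK': "K \<subseteq> K'"
  proof
    fix p assume "p \<in> K"
    then have "(\<lambda>(h, q). H_mult (H_inv (g h)) q) (0, p) \<in> K'"
      unfolding K'_def by (intro imageI) auto
    moreover have "H_mult (H_inv (g 0)) p = p" unfolding g(2) by (cases p) simp
    ultimately show "p \<in> K'" by simp
  qed
  have "continuous_on UNIV (\<lambda>p. frechet_derivative \<phi> (at p) ((\<lambda>(h, p). R h p) (0, p)))"
    by (intro continuous_on_frechet_derivative[OF \<phi>] continuous_on_compose2[OF R(2)] continuous_intros) auto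
  then have "integrable \<mu> (f' 0)"
    by (intro integrable_continuous_compact_support[OF _ K off]) (simp add: f'0)
  moreover have off': "f' 0 p = 0" if "p \<notin> K'" for p
    using off[of p] KK' that by auto
  have "(LINT p|\<mu>. f' 0 p) = 0"
    using 0 set_integral_eq_integral_support(1)[of K' "f' 0" \<mu>, OF off'] by simp
  ultimately show ?thesis by (simp add: f'0[abs_def] has_bochner_integral_iff)
qed

end

lemma integral_haar_pos:
  fixes f :: "real4 \<Rightarrow> real"
  assumes haar: "left_haar_measure (H_group \<mu>) \<mu>"
    and f: "continuous_on UNIV f" "integrable \<mu> f" "\<And>p. f p \<ge> 0" and pos: "\<exists>p. f p > 0"
  shows "(LINT p|\<mu>. f p) > 0"
proof (rule ccontr)
  assume "\<not> (LINT p|\<mu>. f p) > 0"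
  then have "(LINT p|\<mu>. f p) = 0" using Bochner_Integration.integral_nonneg[of \<mu> f, OF f(3)] by linarith
  then have "AE p in \<mu>. f p = 0"
    using integral_nonneg_eq_0_iff_AE[OF f(2)] f(3) by simp
  moreover have op: "open (f -` {0<..})" using f(1) by (intro open_vimage) auto
  moreover have "{p \<in> space \<mu>. f p \<noteq> 0} = f -` {0<..}"
    using f(3) by (auto simp: space_haar[OF haar] less_le simp del: split_paired_All)
  ultimately have "emeasure \<mu> (f -` {0<..}) = 0"
    using AE_iff_measurable[of "f -` {0<..}" \<mu> "\<lambda>p. f p = 0"] by (simp add: sets_haar[OF haar])
  moreover have "f -` {0<..} \<noteq> {}" using pos by auto
  ultimately show False using emeasure_haar_open_pos[OF haar op] by simp
qed

text \<open>
  Integration by parts for the left-invariant field \<open>Y\<^sub>3 = \<partial>\<^sub>t\<close>, whose divergence with respect to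
  a left Haar measure is \<open>- tr ad Y\<^sub>3 = - 4\<close>. This is read off from left invariance alone: \<open>Y\<^sub>3\<close> is the right-invariant field \<open>x \<partial>\<^sub>x + y \<partial>\<^sub>y + 2 z \<partial>\<^sub>z + \<partial>\<^sub>t\<close> minus the
  combination, with coefficients \<open>x\<close>, \<open>y\<close>, \<open>2 z\<close>, of the right-invariant fields
  \<open>\<partial>\<^sub>x + y/2 \<partial>\<^sub>z\<close>, \<open>\<partial>\<^sub>y - x/2 \<partial>\<^sub>z\<close>, \<open>\<partial>\<^sub>z\<close>. Right-invariant fields integrate to zero on every test function;
  applying the last three to \<open>x \<phi>\<close>, \<open>y \<phi>\<close>, \<open>z \<phi>\<close> and weighting by \<open>1\<close>, \<open>1\<close>, \<open>2\<close>, the product rule yields \<open>4 \<phi>\<close>.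
\<close>

lemma has_bochner_integral_vertical_derivative:
  fixes \<phi> :: "real4 \<Rightarrow> real"
  assumes haar: "left_haar_measure (H_group \<mu>) \<mu>"
    and \<phi>: "Ck_on 1 UNIV \<phi>" and K: "compact K" and supp: "\<And>p. p \<notin> K \<Longrightarrow> \<phi> p = 0"
  shows "has_bochner_integral \<mu> (\<lambda>p. frechet_derivative \<phi> (at p) Y3 - 4 * \<phi> p) 0"
proof -
  let ?D = "\<lambda>p. frechet_derivative \<phi> (at p)"
  note D = Ck_on_1_has_derivative[OF \<phi> UNIV_I]
  note inv = integral_right_invariant_derivative[OF haar _ K]
  have prod: "Ck_on 1 UNIV (\<lambda>p. c p * \<phi> p)"
    "frechet_derivative (\<lambda>p. c p * \<phi> p) (at p) v = c p * ?D p v + c v * \<phi> p"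
    if "bounded_linear c" for c :: "real4 \<Rightarrow> real" and p v
  proof -
    show "Ck_on 1 UNIV (\<lambda>p. c p * \<phi> p)"
      by (rule Ck_on_mult[OF open_UNIV Ck_on_linear[OF open_UNIV that] \<phi>])
    have "((\<lambda>p. c p * \<phi> p) has_derivative (\<lambda>v. c p * ?D p v + c v * \<phi> p)) (at p)"
      by (rule has_derivative_mult[OF bounded_linear_imp_has_derivative[OF that] D])
    from fun_cong[OF frechet_derivative_at[OF this], of v] show
      "frechet_derivative (\<lambda>p. c p * \<phi> p) (at p) v = c p * ?D p v + c v * \<phi> p" by (rule sym)
  qed
  have bl: "bounded_linear (\<lambda>p::real4. fst p)" "bounded_linear (\<lambda>p::real4. fst (snd p))"
    "bounded_linear (\<lambda>p::real4. fst (snd (snd p)))"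
    by (intro bounded_linear_fst_snd bounded_linear_ident)+
  \<comment> \<open>The right-invariant fields generated by left translations by \<open>exp (h Y\<^sub>3)\<close>, \<open>exp (h Y\<^sub>1)\<close>, \<open>exp (h Y\<^sub>2)\<close>
    and \<open>exp (h Z)\<close>, the last three applied to the multiples of \<open>\<phi>\<close> by a coordinate.\<close>
  have E: "has_bochner_integral \<mu> (\<lambda>p. ?D p (fst p, fst (snd p), 2 * fst (snd (snd p)), 1)) 0"
  proof -
    let ?R = "\<lambda>h p :: real4. (exp h * fst p, exp h * fst (snd p), exp (2 * h) * 2 * fst (snd (snd p)), 1 :: real)"
    have "has_bochner_integral \<mu> (\<lambda>p. ?D p (?R 0 p)) 0"
    proof (rule inv[OF \<phi> supp, of "\<lambda>h. (0, 0, 0, h)"])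
      show "((\<lambda>h. H_mult (0, 0, 0, h) p) has_vector_derivative ?R h p) (at h)" for h p
        unfolding H_mult_eq by (auto intro!: derivative_eq_intros
            simp: has_real_derivative_iff_has_vector_derivative[symmetric])
    qed (auto simp: case_prod_unfold intro!: continuous_intros)
    then show ?thesis by (simp only: exp_zero mult_1 mult_zero_right)
  qed
  have A: "has_bochner_integral \<mu> (\<lambda>p. frechet_derivative (\<lambda>p. fst p * \<phi> p) (at p) (1, 0, fst (snd p) / 2, 0)) 0"
  proof (rule inv[OF prod(1)[OF bl(1)], of "\<lambda>h. (h, 0, 0, 0)" "\<lambda>h p. (1, 0, fst (snd p) / 2, 0)"])
    show "((\<lambda>h. H_mult (h, 0, 0, 0) p) has_vector_derivative (1, 0, fst (snd p) / 2, 0)) (at h)" for h p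
      unfolding H_mult_eq by (auto intro!: derivative_eq_intros
          simp: has_real_derivative_iff_has_vector_derivative[symmetric])
  qed (auto simp: supp case_prod_unfold intro!: continuous_intros)
  have B: "has_bochner_integral \<mu> (\<lambda>p. frechet_derivative (\<lambda>p. fst (snd p) * \<phi> p) (at p) (0, 1, - fst p / 2, 0)) 0"
  proof (rule inv[OF prod(1)[OF bl(2)], of "\<lambda>h. (0, h, 0, 0)" "\<lambda>h p. (0, 1, - fst p / 2, 0)"])
    show "((\<lambda>h. H_mult (0, h, 0, 0) p) has_vector_derivative (0, 1, - fst p / 2, 0)) (at h)" for h p
      unfolding H_mult_eq by (auto intro!: derivative_eq_intros
          simp: has_real_derivative_iff_has_vector_derivative[symmetric])
  qed (auto simp: supp case_prod_unfold intro!: continuous_intros)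
  have C: "has_bochner_integral \<mu> (\<lambda>p. frechet_derivative (\<lambda>p. fst (snd (snd p)) * \<phi> p) (at p) (0, 0, 1, 0)) 0"
  proof (rule inv[OF prod(1)[OF bl(3)], of "\<lambda>h. (0, 0, h, 0)" "\<lambda>h p. (0, 0, 1, 0)"])
    show "((\<lambda>h. H_mult (0, 0, h, 0) p) has_vector_derivative (0, 0, 1, 0)) (at h)" for h p
      unfolding H_mult_eq by (auto intro!: derivative_eq_intros
          simp: has_real_derivative_iff_has_vector_derivative[symmetric])
  qed (auto simp: supp case_prod_unfold intro!: continuous_intros)
  have lin: "?D p (x, y, z, t) = x * ?D p Y1 + y * ?D p Y2 + z * ?D p Z + t * ?D p Y3" for p x y z t
  proof -
    interpret linear "?D p" using D has_derivative_linear by blast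
    have "(x, y, z, t) = x *\<^sub>R Y1 + y *\<^sub>R Y2 + z *\<^sub>R Z + t *\<^sub>R Y3"
      by (simp add: Y1_def Y2_def Y3_def Z_def)
    then show ?thesis by (simp only: add scale real_scaleR_def)
  qed
  have "has_bochner_integral \<mu> (\<lambda>p. ?D p (fst p, fst (snd p), 2 * fst (snd (snd p)), 1)
      - frechet_derivative (\<lambda>p. fst p * \<phi> p) (at p) (1, 0, fst (snd p) / 2, 0)
      - frechet_derivative (\<lambda>p. fst (snd p) * \<phi> p) (at p) (0, 1, - fst p / 2, 0)
      - 2 * frechet_derivative (\<lambda>p. fst (snd (snd p)) * \<phi> p) (at p) (0, 0, 1, 0)) (0 - 0 - 0 - 2 * 0)"
    by (intro has_bochner_integral_diff has_bochner_integral_mult_right E A B C)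
  moreover have "?D p (fst p, fst (snd p), 2 * fst (snd (snd p)), 1)
      - frechet_derivative (\<lambda>p. fst p * \<phi> p) (at p) (1, 0, fst (snd p) / 2, 0)
      - frechet_derivative (\<lambda>p. fst (snd p) * \<phi> p) (at p) (0, 1, - fst p / 2, 0)
      - 2 * frechet_derivative (\<lambda>p. fst (snd (snd p)) * \<phi> p) (at p) (0, 0, 1, 0)
      = ?D p Y3 - 4 * \<phi> p" for p
    unfolding prod(2)[OF bl(1)] prod(2)[OF bl(2)] prod(2)[OF bl(3)] lin by (simp add: field_simps)
  ultimately show ?thesis by simp
qed

section \<open>Lie differentials of maps of \<open>H\<close>\<close>

lemma H_mult_H_inv:
  "H_mult (H_inv (x, y, z, t)) (x', y', z', t') =
    (exp (- t) * (x' - x), exp (- t) * (y' - y), exp (- 2 * t) * (z' - z - (x * y' - y * x') / 2), t' - t)"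
proof -
  have "exp (- t * 2) = exp (- t) * exp (- t)" by (simp flip: exp_add)
  then show ?thesis by (simp add: field_simps)
qed

text \<open>
  The Lie differential is the Maurer-Cartan form of \<open>H\<close>, in coordinates, applied to the ordinary
  derivative of \<open>F\<close> along the left-invariant field. Its third component carries the contact form
  \<open>dz - (x dy - y dx)/2\<close>.
\<close>

lemma DF_H:
  assumes F: "(F has_derivative F') (at p)"
    and P: "F p = (x, y, z, t)" and w: "F' (left_field (H_group \<mu>) v p) = (a, b, c, d)"
  shows "DF (H_group \<mu>) (H_group \<nu>) F p v =
    (exp (- t) * a, exp (- t) * b, exp (- 2 * t) * (c - (x * b - y * a) / 2), d)"
proof -
  obtain v1 v2 v3 v4 where v: "v = (v1, v2, v3, v4)" by (cases v)
  obtain x' y' z' t' where p: "p = (x', y', z', t')" by (cases p)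
  define \<gamma> where "\<gamma> h = H_mult p (H_sub v h)" for h
  have "(\<gamma> has_vector_derivative left_field (H_group \<mu>) v p) (at 0)"
    unfolding v p left_field_H \<gamma>_def
    using expint_deriv[of v4 0] expint_deriv[of "2 * v4" 0]
    by (auto intro!: derivative_eq_intros simp: has_real_derivative_iff_has_vector_derivative[symmetric])
  moreover have \<gamma>0: "\<gamma> 0 = p" by (simp add: \<gamma>_def v p)
  ultimately have "((F \<circ> \<gamma>) has_vector_derivative (a, b, c, d)) (at 0)"
    using vector_derivative_diff_chain_within[of \<gamma> _ 0 UNIV F F'] has_derivative_at_withinI[OF F]
    by (metis w)
  then have F\<gamma>: "((\<lambda>h. F (\<gamma> h)) has_derivative (\<lambda>h. h *\<^sub>R (a, b, c, d))) (at 0)"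
    by (simp add: has_vector_derivative_def comp_def)
  have comps: "((\<lambda>h. fst (F (\<gamma> h))) has_real_derivative a) (at 0)"
    "((\<lambda>h. fst (snd (F (\<gamma> h)))) has_real_derivative b) (at 0)"
    "((\<lambda>h. fst (snd (snd (F (\<gamma> h))))) has_real_derivative c) (at 0)"
    "((\<lambda>h. snd (snd (snd (F (\<gamma> h))))) has_real_derivative d) (at 0)"
    using has_derivative_fst[OF F\<gamma>] has_derivative_fst[OF has_derivative_snd[OF F\<gamma>]]
      has_derivative_fst[OF has_derivative_snd[OF has_derivative_snd[OF F\<gamma>]]]
      has_derivative_snd[OF has_derivative_snd[OF has_derivative_snd[OF F\<gamma>]]]
    by (simp_all add: has_field_derivative_def mult_commute_abs)
  have "((\<lambda>h. H_mult (H_inv (x, y, z, t)) (f1 h, f2 h, f3 h, f4 h)) has_vector_derivative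
      (exp (- t) * a, exp (- t) * b, exp (- 2 * t) * (c - (x * b - y * a) / 2), d)) (at 0)"
    if "(f1 has_real_derivative a) (at 0)" "(f2 has_real_derivative b) (at 0)"
      "(f3 has_real_derivative c) (at 0)" "(f4 has_real_derivative d) (at 0)" for f1 f2 f3 f4
    unfolding H_mult_H_inv using that
    by (auto intro!: derivative_eq_intros simp: has_real_derivative_iff_has_vector_derivative[symmetric])
  from this[OF comps] have "((\<lambda>h. H_mult (H_inv (F p)) (F (\<gamma> h))) has_vector_derivative
      (exp (- t) * a, exp (- t) * b, exp (- 2 * t) * (c - (x * b - y * a) / 2), d)) (at 0)"
    by (simp only: P prod.collapse)
  then show ?thesis
    unfolding DF_def lie_exp_H_scale H_simps m_inv_H \<gamma>_def by (rule vector_derivative_at)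
qed

lemma polarization_eq: "span {Y1, Y2, Y3} = {(a, b, 0, d) | a b d. True}"
proof -
  have "span {Y1, Y2, Y3} = (\<lambda>(a, b, d). a *\<^sub>R Y1 + b *\<^sub>R Y2 + d *\<^sub>R Y3) ` UNIV"
    by (auto simp: span_insert span_singleton image_def algebra_simps)
  then show ?thesis by (auto simp: Y1_def Y2_def Y3_def image_def)
qed

definition vertical_map :: "(real4 \<Rightarrow> real) \<Rightarrow> real4 \<Rightarrow> real4" where
  "vertical_map T p = (fst p, fst (snd p), fst (snd (snd p)), T p)"

text \<open>
  The third component is \<open>0\<close> whatever \<open>T\<close> is, because the contact form does not involve \<open>t\<close>: this
  makes all vertical maps contact. The factor \<open>exp (t - T)\<close> appears because the first two fields of
  the frame scale like \<open>e\<^sup>t\<close>.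
\<close>

lemma DF_vertical_map:
  assumes "(T has_derivative T') (at (x, y, z, t))"
  shows "DF (H_group \<mu>) (H_group \<mu>) (vertical_map T) (x, y, z, t) (a, b, 0, d) =
    (exp (t - T (x, y, z, t)) * a, exp (t - T (x, y, z, t)) * b, 0,
     T' (left_field (H_group \<mu>) (a, b, 0, d) (x, y, z, t)))"
proof -
  have "(vertical_map T has_derivative (\<lambda>v. (fst v, fst (snd v), fst (snd (snd v)), T' v))) (at (x, y, z, t))"
    unfolding vertical_map_def[abs_def] by (intro derivative_intros assms)
  from DF_H[OF this, of x y z "T (x, y, z, t)" \<mu> "(a, b, 0, d)" "exp t * a" "exp t * b"
      "exp t * (x * b - y * a) / 2" "T' (left_field (H_group \<mu>) (a, b, 0, d) (x, y, z, t))" \<mu>]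
  show ?thesis
    by (simp add: vertical_map_def left_field_H exp_diff exp_minus field_simps)
qed

lemma onb_H: "orthonormal_basis (H_group \<mu>) (onb (H_group \<mu>))"
  unfolding onb_def using orthonormal_basis_H by (rule someI)

text \<open>
  The orthonormal basis of the polarization is arbitrary, so the density is computed as a sum
  of three sums of squares \<open>(X \<bullet> w)\<^sup>2\<close>, each of which is \<open>w \<bullet> w\<close> by Parseval's identity.
\<close>

lemma energy_density_vertical_map:
  assumes T: "(T has_derivative T') (at p)"
  shows "energy_density (H_group \<mu>) (H_group \<mu>) (vertical_map T) p =
    2 * exp (2 * (snd (snd (snd p)) - T p))
    + (T' (left_field (H_group \<mu>) Y1 p))\<^sup>2 + (T' (left_field (H_group \<mu>) Y2 p))\<^sup>2
    + (T' (left_field (H_group \<mu>) Y3 p))\<^sup>2"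
proof -
  obtain x y z t where p: "p = (x, y, z, t)" by (cases p)
  let ?l = "\<lambda>v. T' (left_field (H_group \<mu>) v p)" and ?e = "exp (t - T p)"
  let ?w = "(?l Y1, ?l Y2, 0, ?l Y3)"
  define B where "B = onb (H_group \<mu>)"
  have B: "finite B" "span B = span {Y1, Y2, Y3}" "\<forall>v\<in>B. \<forall>w\<in>B. v \<bullet> w = (if v = w then 1 else 0)"
    using onb_H[of \<mu>] by (simp_all add: B_def orthonormal_basis_def)
  have density: "DF (H_group \<mu>) (H_group \<mu>) (vertical_map T) p X \<bullet> DF (H_group \<mu>) (H_group \<mu>) (vertical_map T) p X
      = ?e\<^sup>2 * (X \<bullet> Y1)\<^sup>2 + ?e\<^sup>2 * (X \<bullet> Y2)\<^sup>2 + (X \<bullet> ?w)\<^sup>2" if "X \<in> B" for X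
  proof -
    have "X \<in> span B" using that by (rule span_base)
    then obtain a b d where X: "X = (a, b, 0, d)" unfolding B(2) polarization_eq by blast
    interpret linear T' using T by (rule has_derivative_linear)
    have "left_field (H_group \<mu>) X p = a *\<^sub>R left_field (H_group \<mu>) Y1 p
        + b *\<^sub>R left_field (H_group \<mu>) Y2 p + d *\<^sub>R left_field (H_group \<mu>) Y3 p"
      by (simp add: X p Y1_def Y2_def Y3_def left_field_H field_simps)
    then have "?l X = a * ?l Y1 + b * ?l Y2 + d * ?l Y3"
      by (simp only: add scale real_scaleR_def)
    also have "\<dots> = X \<bullet> ?w" by (simp add: X)
    finally have l: "?l X = X \<bullet> ?w" .
    have "DF (H_group \<mu>) (H_group \<mu>) (vertical_map T) p X = (?e * a, ?e * b, 0, ?l X)"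
      using DF_vertical_map[OF T[unfolded p], of \<mu> a b d] by (simp add: X p)
    moreover have "X \<bullet> Y1 = a" "X \<bullet> Y2 = b" by (simp_all add: X Y1_def Y2_def)
    ultimately show ?thesis unfolding l by (simp add: power2_eq_square algebra_simps)
  qed
  have Parseval: "(\<Sum>X\<in>B. (X \<bullet> w)\<^sup>2) = w \<bullet> w" if "w \<in> span {Y1, Y2, Y3}" for w
    using Parseval[OF B(1,3)] that B(2) by simp
  have "energy_density (H_group \<mu>) (H_group \<mu>) (vertical_map T) p =
      ?e\<^sup>2 * (\<Sum>X\<in>B. (X \<bullet> Y1)\<^sup>2) + ?e\<^sup>2 * (\<Sum>X\<in>B. (X \<bullet> Y2)\<^sup>2) + (\<Sum>X\<in>B. (X \<bullet> ?w)\<^sup>2)"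
    using density by (simp add: energy_density_def sum.distrib sum_distrib_left flip: B_def)
  also have "\<dots> = ?e\<^sup>2 * (Y1 \<bullet> Y1) + ?e\<^sup>2 * (Y2 \<bullet> Y2) + ?w \<bullet> ?w"
    using Parseval[of Y1] Parseval[of Y2] Parseval[of ?w]
    by (simp add: span_base) (simp add: polarization_eq)
  also have "?e\<^sup>2 = exp (2 * (t - T p))" by (simp add: power2_eq_square flip: exp_add)
  finally show ?thesis
    by (simp add: p Y1_def Y2_def power2_eq_square)
qed

section \<open>The identity as a harmonic morphism\<close>

lemma DF_identity: "DF (H_group \<mu>) (H_group \<mu>) (\<lambda>p. p) p v = v"
proof -
  obtain x y z t where p: "p = (x, y, z, t)" by (cases p)
  obtain a b c d where v: "v = (a, b, c, d)" by (cases v)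
  have "exp (- 2 * t) * exp (2 * t) = 1" "exp (- t) * exp t = 1" for t :: real by (simp_all flip: exp_add)
  then show ?thesis
    using DF_H[OF has_derivative_ident p left_field_H[of \<mu> a b c d x y z t, folded p v], of \<mu>]
    by (simp add: v field_simps)
qed

lemma Ck_on_subset: "Ck_on k S f \<Longrightarrow> T \<subseteq> S \<Longrightarrow> Ck_on k T f"
  by (induction k arbitrary: f) (auto intro: continuous_on_subset)

text \<open>
  A test function supported in a compact subset of \<open>V\<close> is a test function on \<open>U\<close>, and its derivative
  vanishes on \<open>U - V\<close>.
\<close>

lemma harmonic_on_subset:
  fixes G :: "'a::euclidean_space sr_group"
  assumes "harmonic_on G U u" "V \<subseteq> U"
  shows "harmonic_on G V u"
proof -
  let ?X = "\<lambda>p. \<Sum>X\<in>onb G. left_deriv G X u p *\<^sub>R left_field G X p"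
  have zero: "(LINT p:V|vol G. frechet_derivative \<phi> (at p) (?X p)) = 0"
    if \<phi>: "smooth_on UNIV \<phi>" and K: "compact K" "K \<subseteq> V" and supp: "\<And>p. p \<notin> K \<Longrightarrow> \<phi> p = 0"
    for \<phi> :: "'a \<Rightarrow> real" and K
  proof -
    let ?d = "\<lambda>p. frechet_derivative \<phi> (at p) (?X p)"
    have "?d p = 0" if "p \<notin> K" for p
      using K(1) supp that by (rule frechet_derivative_eq_0_off_support)
    then have off: "\<And>p. p \<notin> V \<Longrightarrow> ?d p = 0" "\<And>p. p \<notin> U \<Longrightarrow> ?d p = 0"
      using K(2) assms(2) by (meson subsetD)+
    have "(LINT p:V|vol G. ?d p) = (LINT p:U|vol G. ?d p)"
      using set_integral_eq_integral_support(1)[of V ?d "vol G", OF off(1)]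
        set_integral_eq_integral_support(1)[of U ?d "vol G", OF off(2)] by (rule trans[OF _ sym])
    moreover have "K \<subseteq> U" using K(2) assms(2) by (rule subset_trans)
    then have "(LINT p:U|vol G. 0 * \<phi> p) = - (LINT p:U|vol G. ?d p)"
      using assms(1) \<phi> K(1) supp unfolding harmonic_on_def is_sub_laplacian_def is_divergence_def by blast
    ultimately show ?thesis by simp
  qed
  have "is_divergence G V ?X (\<lambda>_. 0)"
    unfolding is_divergence_def
  proof (intro conjI allI impI)
    fix \<phi> :: "'a \<Rightarrow> real" and K
    assume "smooth_on UNIV \<phi> \<and> compact K \<and> K \<subseteq> V \<and> (\<forall>p. p \<notin> K \<longrightarrow> \<phi> p = 0)"
    then show "(LINT p:V|vol G. 0 * \<phi> p) = - (LINT p:V|vol G. frechet_derivative \<phi> (at p) (?X p))"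
      using zero[of \<phi> K] by simp
  qed (rule continuous_on_const)
  moreover have "smooth_on V u"
    using assms by (auto simp: harmonic_on_def smooth_on_def intro: Ck_on_subset)
  ultimately show ?thesis by (simp add: harmonic_on_def is_sub_laplacian_def)
qed

lemma harmonic_morphism_identity:
  fixes G :: "'a::euclidean_space sr_group"
  shows "harmonic_morphism G G \<Omega> (\<lambda>p. p)"
  unfolding harmonic_morphism_def
proof (intro conjI allI impI)
  fix U u assume "open U \<and> harmonic_on G U u"
  then have "harmonic_on G (\<Omega> \<inter> U) u"
    using harmonic_on_subset[of G U u "\<Omega> \<inter> U"] by simp
  then show "harmonic_on G {p \<in> \<Omega>. p \<in> U} (u \<circ> (\<lambda>p. p))"
    by (simp add: comp_def Int_def)
qed (rule continuous_on_id)

lemma contact_map_identity: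
  assumes "open \<Omega>"
  shows "contact_map (H_group \<mu>) (H_group \<mu>) \<Omega> (\<lambda>p. p)"
  unfolding contact_map_def DF_identity using Ck_on_linear[OF assms bounded_linear_ident, of 1] by simp

text \<open>
  The adjoint of the identity of the polarization is the identity; positive definiteness of
  the scalar product makes it the only candidate.
\<close>

lemma conformal_submersion_identity:
  assumes "open \<Omega>"
  shows "conformal_submersion (H_group \<mu>) (H_group \<mu>) \<Omega> (\<lambda>p. p) (\<lambda>_. 1)"
proof -
  have "sr_adjoint (H_group \<mu>) (H_group \<mu>) (DF (H_group \<mu>) (H_group \<mu>) (\<lambda>p. p) p) w = w"
    if "w \<in> span {Y1, Y2, Y3}" for w p
    unfolding sr_adjoint_def
  proof (rule the_equality)
    fix u assume u: "u \<in> pol (H_group \<mu>) \<and> (\<forall>v\<in>pol (H_group \<mu>). ip (H_group \<mu>) u v =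
      ip (H_group \<mu>) w (DF (H_group \<mu>) (H_group \<mu>) (\<lambda>p. p) p v))"
    then have "u - w \<in> span {Y1, Y2, Y3}" using that by (auto intro: span_diff)
    then have "u \<bullet> (u - w) = w \<bullet> (u - w)" using u by (auto simp: DF_identity simp del: split_paired_All)
    then have "(u - w) \<bullet> (u - w) = 0" by (simp add: inner_diff_left)
    then show "u = w" by simp
  qed (use that in \<open>simp add: DF_identity\<close>)
  then show ?thesis
    unfolding conformal_submersion_def using contact_map_identity[OF assms] by simp
qed

lemma tension_identity: "tension (H_group \<mu>) (H_group \<mu>) (\<lambda>p. p) (\<lambda>_. 1) p = 0"
  by (simp add: tension_def D2F_def DF_identity)

section \<open>Vertical variations of the identity\<close>

locale vertical_variation =
  fixes \<mu> :: "real4 measure" and \<Omega> K :: "real4 set" and \<phi> :: "real4 \<Rightarrow> real"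
  assumes haar: "left_haar_measure (H_group \<mu>) \<mu>"
    and \<Omega>: "open \<Omega>" "bounded \<Omega>"
    and K: "compact K" "K \<subseteq> \<Omega>"
    and smooth: "smooth_on UNIV \<phi>"
    and supp: "\<And>p. p \<notin> K \<Longrightarrow> \<phi> p = 0"
begin

abbreviation "H \<equiv> H_group \<mu>"

text \<open>
  The coordinate \<open>t\<close> of the varied map. Points are pushed down when \<open>s > 0\<close> and \<open>\<phi> \<ge> 0\<close>, the
  direction in which the energy decreases. The body is a sum of products, the form to which the
  closure rules for \<open>C\<^sup>k\<close> functions apply.
\<close>

definition height :: "real \<Rightarrow> real4 \<Rightarrow> real" where
  "height s p = snd (snd (snd p)) + (- s) * \<phi> p"

abbreviation "d\<phi> Y p \<equiv> frechet_derivative \<phi> (at p) (left_field H Y p)"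

lemma Ck_\<phi>: "Ck_on k UNIV \<phi>"
  using smooth by (simp add: smooth_on_def)

lemmas D\<phi> = Ck_on_1_has_derivative[OF Ck_\<phi> UNIV_I]

lemma height_has_derivative:
  "(height s has_derivative (\<lambda>v. snd (snd (snd v)) + (- s) * frechet_derivative \<phi> (at p) v)) (at p)"
  unfolding height_def[abs_def] by (intro derivative_intros D\<phi>)

lemma contact: "contact_map H H \<Omega> (vertical_map (height s))"
  unfolding contact_map_def H_simps polarization_eq
proof (intro conjI ballI)
  show "Ck_on 1 \<Omega> (vertical_map (height s))"
    unfolding vertical_map_def[abs_def] height_def
    by (intro Ck_on_Pair Ck_on_add Ck_on_mult Ck_on_const \<Omega>(1) Ck_on_subset[OF Ck_\<phi>] subset_UNIV;
        rule Ck_on_linear; intro \<Omega>(1) bounded_linear_fst_snd bounded_linear_ident)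
  fix p v :: real4 assume "v \<in> {(a, b, 0, d) | a b d. True}"
  then obtain a b d where v: "v = (a, b, 0, d)" by blast
  obtain x y z t where p: "p = (x, y, z, t)" by (cases p)
  show "DF H H (vertical_map (height s)) p v \<in> {(a, b, 0, d) | a b d. True}"
    unfolding v p DF_vertical_map[OF height_has_derivative] by blast
qed

lemma contact_variation: "contact_variation H H \<Omega> (\<lambda>p. p) 1 K (\<lambda>s. vertical_map (height s))"
  unfolding contact_variation_def
proof (intro conjI ballI)
  have op: "open ({- 1<..<1 :: real} \<times> \<Omega>)" by (intro open_Times open_greaterThanLessThan \<Omega>)
  show "smooth_on ({- 1<..<1} \<times> \<Omega>) (\<lambda>(s, p). vertical_map (height s) p)"
    unfolding smooth_on_def case_prod_unfold vertical_map_def height_def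
    by (intro allI Ck_on_Pair Ck_on_add Ck_on_mult Ck_on_const op Ck_on_compose_linear[OF op _ Ck_\<phi>];
        (rule Ck_on_linear)?; intro op bounded_linear_fst_snd bounded_linear_ident bounded_linear_minus)
  show "vertical_map (height 0) p = p" for p by (simp add: vertical_map_def height_def)
  show "vertical_map (height s) p = p" if "p \<in> \<Omega> - K" for s p
    using supp[of p] that by (simp add: vertical_map_def height_def)
qed (simp_all add: K contact)

lemma density:
  "energy_density H H (vertical_map (height s)) p =
    2 * exp (2 * s * \<phi> p) + (s * d\<phi> Y1 p)\<^sup>2 + (s * d\<phi> Y2 p)\<^sup>2 + (1 - s * d\<phi> Y3 p)\<^sup>2"
proof -
  obtain x y z t where p: "p = (x, y, z, t)" by (cases p)
  have "snd (snd (snd (left_field H Y1 p))) = 0" "snd (snd (snd (left_field H Y2 p))) = 0"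
    "snd (snd (snd (left_field H Y3 p))) = 1" "snd (snd (snd p)) - height s p = s * \<phi> p"
    by (simp_all add: p Y1_def Y2_def Y3_def left_field_H height_def)
  then show ?thesis
    unfolding energy_density_vertical_map[OF height_has_derivative] by (simp add: mult.assoc)
qed

lemma continuous_\<phi>: "continuous_on S \<phi>"
  using Ck_\<phi>[of 0] continuous_on_subset by auto

lemma left_field_eqs:
  "left_field H Y1 p = (exp (snd (snd (snd p))), 0, - (exp (snd (snd (snd p))) * fst (snd p)) / 2, 0)"
  "left_field H Y2 p = (0, exp (snd (snd (snd p))), exp (snd (snd (snd p))) * fst p / 2, 0)"
  "left_field H Y3 p = Y3"
  by (cases p; simp add: Y1_def Y2_def Y3_def left_field_H)+

lemma continuous_d\<phi>: "continuous_on S (d\<phi> Y1)" "continuous_on S (d\<phi> Y2)" "continuous_on S (d\<phi> Y3)"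
  unfolding left_field_eqs
  by (intro continuous_on_frechet_derivative[OF Ck_\<phi>] continuous_intros; simp)+

lemma d\<phi>_off_support: "p \<notin> K \<Longrightarrow> d\<phi> Y p = 0"
  using K(1) supp by (rule frechet_derivative_eq_0_off_support)

lemma continuous_density: "continuous_on S (energy_density H H (vertical_map (height s)))"
  unfolding density[abs_def] by (intro continuous_intros continuous_\<phi> continuous_d\<phi>)

text \<open>
  The terms in \<open>Y\<^sub>1\<phi>\<close> and \<open>Y\<^sub>2\<phi>\<close> are quadratic in \<open>s\<close>, so that at \<open>s = 0\<close> the density has the derivative
  \<open>4 \<phi> - 2 Y\<^sub>3\<phi>\<close>. Integration by parts turns its integral into \<open>(4 - 8) \<integral> \<phi>\<close>.
\<close>

lemma energy_has_derivative:
  "((\<lambda>s. 1/2 * (LINT p:K|\<mu>. energy_density H H (vertical_map (height s)) p))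
     has_real_derivative - 2 * (LINT p|\<mu>. \<phi> p)) (at 0)"
proof -
  let ?f' = "\<lambda>s p. 4 * \<phi> p * exp (2 * s * \<phi> p) + 2 * s * (d\<phi> Y1 p)\<^sup>2 + 2 * s * (d\<phi> Y2 p)\<^sup>2
    - 2 * d\<phi> Y3 p * (1 - s * d\<phi> Y3 p)"
  have "((\<lambda>s. LINT p:K|\<mu>. energy_density H H (vertical_map (height s)) p)
      has_real_derivative (LINT p:K|\<mu>. ?f' 0 p)) (at 0)"
  proof (rule has_real_derivative_set_integral_compact[OF sets_haar[OF haar] K(1)
        haar_compact[OF haar K(1)] zero_less_one continuous_density])
    show "((\<lambda>s. energy_density H H (vertical_map (height s)) p) has_real_derivative ?f' s p) (at s)" for s p
      unfolding density by (auto intro!: derivative_eq_intros simp: power2_eq_square algebra_simps)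
    have c: "continuous_on ({- 1..1} \<times> K) (\<lambda>x. g (snd x))"
      if "continuous_on UNIV g" for g :: "real4 \<Rightarrow> real"
      using that by (rule continuous_on_compose2) (auto intro!: continuous_intros)
    show "continuous_on ({- 1..1} \<times> K) (\<lambda>(s, p). ?f' s p)"
      unfolding case_prod_unfold by (intro continuous_intros c continuous_\<phi> continuous_d\<phi>)
  qed
  moreover have "(LINT p:K|\<mu>. ?f' 0 p) = - 4 * (LINT p|\<mu>. \<phi> p)"
  proof -
    have "(LINT p:K|\<mu>. ?f' 0 p) = (LINT p|\<mu>. ?f' 0 p)"
      using supp d\<phi>_off_support by (intro set_integral_eq_integral_support) simp
    also have "\<dots> = (LINT p|\<mu>. - 2 * (frechet_derivative \<phi> (at p) Y3 - 4 * \<phi> p) - 4 * \<phi> p)"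
      by (simp add: left_field_eqs algebra_simps)
    also have "\<dots> = - 2 * 0 - 4 * (LINT p|\<mu>. \<phi> p)"
      using integrable_continuous_compact_support[OF haar continuous_\<phi> K(1) supp]
      by (intro has_bochner_integral_integral_eq has_bochner_integral_diff has_bochner_integral_mult_right
          has_bochner_integral_vertical_derivative[OF haar Ck_\<phi> K(1) supp] has_bochner_integral_integrable)
    finally show ?thesis by simp
  qed
  ultimately show ?thesis
    by (auto intro!: derivative_eq_intros)
qed

text \<open>
  Off \<open>K\<close> the map is the identity, whose energy density is \<open>3\<close>.
\<close>

lemma energy_eq:
  "energy H H \<Omega> (vertical_map (height s)) =
    ennreal (1/2) * (3 * emeasure \<mu> (\<Omega> - K) + ennreal (LINT p:K|\<mu>. energy_density H H (vertical_map (height s)) p))"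
proof -
  let ?e = "energy_density H H (vertical_map (height s))"
  have [measurable]: "\<Omega> - K \<in> sets \<mu>" "K \<in> sets \<mu>" "?e \<in> borel_measurable \<mu>"
    using \<Omega>(1) K(1) borel_measurable_continuous_onI[OF continuous_density]
    by (auto simp: sets_haar[OF haar] borel_compact cong: measurable_cong_sets)
  have "(\<integral>\<^sup>+p\<in>\<Omega>. ennreal (?e p) \<partial>\<mu>)
      = (\<integral>\<^sup>+p. 3 * indicator (\<Omega> - K) p + ennreal (indicator K p *\<^sub>R ?e p) \<partial>\<mu>)"
  proof (rule nn_integral_cong)
    fix p
    have "?e p = 3" if "p \<notin> K" using that by (simp add: density supp d\<phi>_off_support)
    then show "ennreal (?e p) * indicator \<Omega> p = 3 * indicator (\<Omega> - K) p + ennreal (indicator K p *\<^sub>R ?e p)"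
      using K(2) by (auto simp: indicator_def)
  qed
  also have "\<dots> = 3 * emeasure \<mu> (\<Omega> - K) + (\<integral>\<^sup>+p. ennreal (indicator K p *\<^sub>R ?e p) \<partial>\<mu>)"
    by (simp add: nn_integral_add nn_integral_cmult_indicator)
  also have "(\<integral>\<^sup>+p. ennreal (indicator K p *\<^sub>R ?e p) \<partial>\<mu>) = ennreal (LINT p:K|\<mu>. ?e p)"
    unfolding set_lebesgue_integral_def
    using set_integrable_continuous_on_compact[OF sets_haar[OF haar] K(1) haar_compact[OF haar K(1)] continuous_density]
    by (intro nn_integral_eq_integral) (auto simp: set_integrable_def density indicator_def)
  finally show ?thesis unfolding energy_def by simp
qed

text \<open>
  The part of the energy off \<open>K\<close> is finite because \<open>\<Omega>\<close> is bounded, so it cancels from the comparison.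
\<close>

lemma energy_less:
  assumes "(LINT p:K|\<mu>. energy_density H H (vertical_map (height s)) p)
    < (LINT p:K|\<mu>. energy_density H H (vertical_map (height s')) p)"
  shows "energy H H \<Omega> (vertical_map (height s)) < energy H H \<Omega> (vertical_map (height s'))"
proof -
  have "emeasure \<mu> (\<Omega> - K) \<le> emeasure \<mu> (closure \<Omega>)"
    using closure_subset by (intro emeasure_mono) (auto simp: sets_haar[OF haar])
  also have "\<dots> < \<infinity>" using \<Omega>(2) by (intro haar_compact[OF haar]) (simp add: compact_closure)
  finally obtain m where m: "emeasure \<mu> (\<Omega> - K) = ennreal m" "m \<ge> 0"
    by (cases "emeasure \<mu> (\<Omega> - K)") auto
  have "0 \<le> (LINT p:K|\<mu>. energy_density H H (vertical_map (height s)) p)"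
    unfolding set_lebesgue_integral_def by (intro Bochner_Integration.integral_nonneg) (auto simp: density)
  \<comment> \<open>An opaque name for the factor, which simplification would otherwise rewrite to an inverse
    that no longer combines with the other \<open>ennreal\<close> terms.\<close>
  moreover define h :: real where "h = 1 / 2"
  then have "h > 0" by simp
  ultimately show ?thesis
    using assms m unfolding energy_eq h_def[symmetric]
    by (simp add: ennreal_less_iff flip: ennreal_numeral ennreal_mult ennreal_plus)
qed

end

theorem theorem9p3:
  fixes \<mu> :: "real4 measure" and \<Omega> :: "real4 set"
  assumes "left_haar_measure (H_group \<mu>) \<mu>"
    and "open \<Omega>" and "\<Omega> \<noteq> {}" and "bounded \<Omega>"
  shows "let H = H_group \<mu>; F = (\<lambda>p::real4. p) in
     (harmonic_morphism H H \<Omega> F \<and>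
      conformal_submersion H H \<Omega> F (\<lambda>_. 1) \<and>
      (\<forall>p\<in>\<Omega>. tension H H F (\<lambda>_. 1) p = 0)) \<and>
     (\<not> harmonic_map H H \<Omega> F \<and>
      (\<exists>\<epsilon> K Fs. contact_variation H H \<Omega> F \<epsilon> K Fs \<and>
         (\<forall>\<^sub>F s in at_right 0. energy H H \<Omega> (Fs s) < energy H H \<Omega> F)))"
proof -
  let ?H = "H_group \<mu>"
  obtain \<phi> :: "real4 \<Rightarrow> real" and K where \<phi>: "smooth_on UNIV \<phi>" "compact K" "K \<subseteq> \<Omega>"
    "\<And>p. p \<notin> K \<Longrightarrow> \<phi> p = 0" "\<And>p. \<phi> p \<ge> 0" "\<exists>p. \<phi> p > 0"
    by (rule smooth_bump[OF assms(2,3)]; rule that; assumption)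
  interpret vertical_variation \<mu> \<Omega> K \<phi>
    by unfold_locales (fact assms \<phi>)+
  let ?E = "\<lambda>s. 1/2 * (LINT p:K|\<mu>. energy_density ?H ?H (vertical_map (height s)) p)"
  have pos: "(LINT p|\<mu>. \<phi> p) > 0"
    by (rule integral_haar_pos[OF haar continuous_\<phi> _ \<phi>(5,6)])
      (rule integrable_continuous_compact_support[OF haar continuous_\<phi> K(1) supp])
  have "\<not> harmonic_map ?H ?H \<Omega> (\<lambda>p. p)"
  proof
    assume "harmonic_map ?H ?H \<Omega> (\<lambda>p. p)"
    then have "(?E has_real_derivative 0) (at 0)"
      using contact_variation unfolding harmonic_map_def H_simps by blast
    then show False using DERIV_unique[OF energy_has_derivative] pos by fastforce
  qed
  moreover have "\<forall>\<^sub>F s in at_right 0. energy ?H ?H \<Omega> (vertical_map (height s)) < energy ?H ?H \<Omega> (\<lambda>p. p)"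
  proof -
    have "- 2 * (LINT p|\<mu>. \<phi> p) < 0" using pos by simp
    from DERIV_neg_dec_right[OF energy_has_derivative this] obtain d where "d > 0"
      and "\<And>s. 0 < s \<Longrightarrow> s < d \<Longrightarrow> ?E s < ?E 0" by auto
    moreover have "vertical_map (height 0) = (\<lambda>p. p)" by (rule ext) (simp add: vertical_map_def height_def)
    ultimately show ?thesis
      unfolding eventually_at_right_field using energy_less[of _ 0] by (intro exI[of _ d]) auto
  qed
  ultimately show ?thesis
    using harmonic_morphism_identity conformal_submersion_identity tension_identity contact_variation assms(2)
    unfolding Let_def by blast
qed

end
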